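(* Let $n\ge 2$ and $t\ge 3$. Under the action of the collineation group of $\Lambda=PG(2n-1,q^t)$, the maximum scattered $\mathbb{F}_q$-linear sets of $\Lambda$ of pseudoregulus type fall into exactly $\varphi(t)/2$ orbits, where $\varphi$ denotes Euler's totient function.
   Context: For an $\mathbb{F}_q$-subspace $U$ of the $2n$-dimensional $\mathbb{F}_{q^t}$-space $V$ with $\Lambda=PG(V,\mathbb{F}_{q^t})$, $L_U=\{\langle\mathbf u\rangle_{q^t}:\mathbf u\in U\setminus\{\mathbf 0\}\}$ is the $\mathbb{F}_q$-linear set defined by $U$, of rank $\dim_{\mathbb F_q}U$; the weight of a subspace $PG(W,\mathbb{F}_{q^t})$ in $L_U$ is $\dim_{\mathbb F_q}(W\cap U)$; $L_U$ is scattered if every point has weight 1, and maximum scattered in $PG(2n-1,q^t)$ if it is scattered of rank $tn$. Pseudoregulus type: a scattered $\mathbb{F}_q$-linear set $L$ of $\Lambda$ of rank $tn$ such that (i) there exist $(q^{nt}-1)/(q^t-1)$ pairwise disjoint lines $s_i$ each of weight $t$ in $L$, and (ii) there exist exactly two $(n-1)$-dimensional subspaces $T_1,T_2$ disjoint from $L$ with $T_j\cap s_i\ne\emptyset$ for all $i,j$. *)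

theory Defs
  imports Main "HOL-Number_Theory.Totient"
begin

text \<open>Vectors of V = F^(2n) are functions 'i => 'a, with 'i a finite index type
  of cardinality 2n and 'a the field F_{q^t}.  Subspaces (over a subfield K of 'a)
  are represented as sets of vectors; projective subspaces of PG(V) are
  F_{q^t}-subspaces of V (points = 1-dimensional, lines = 2-dimensional).\<close>

definition vzero :: "'i \<Rightarrow> 'a::field" where
  "vzero = (\<lambda>i. 0)"

definition vadd :: "('i \<Rightarrow> 'a::field) \<Rightarrow> ('i \<Rightarrow> 'a) \<Rightarrow> ('i \<Rightarrow> 'a)" where
  "vadd u v = (\<lambda>i. u i + v i)"

definition smul :: "'a::field \<Rightarrow> ('i \<Rightarrow> 'a) \<Rightarrow> ('i \<Rightarrow> 'a)" where
  "smul c v = (\<lambda>i. c * v i)"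

definition subsp :: "'a::field set \<Rightarrow> ('i \<Rightarrow> 'a) set \<Rightarrow> bool" where
  "subsp K X \<longleftrightarrow> vzero \<in> X \<and> (\<forall>u\<in>X. \<forall>v\<in>X. vadd u v \<in> X)
     \<and> (\<forall>c\<in>K. \<forall>v\<in>X. smul c v \<in> X)"

definition span :: "'a::field set \<Rightarrow> ('i \<Rightarrow> 'a) set \<Rightarrow> ('i \<Rightarrow> 'a) set" where
  "span K S = \<Inter>{X. subsp K X \<and> S \<subseteq> X}"

definition lin_indep :: "'a::field set \<Rightarrow> ('i \<Rightarrow> 'a) set \<Rightarrow> bool" where
  "lin_indep K B \<longleftrightarrow> finite B \<and>
     (\<forall>c. (\<forall>b\<in>B. c b \<in> K) \<and> (\<forall>i. (\<Sum>b\<in>B. c b * b i) = 0) \<longrightarrow> (\<forall>b\<in>B. c b = 0))"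

definition dimK :: "'a::field set \<Rightarrow> ('i \<Rightarrow> 'a) set \<Rightarrow> nat" where
  "dimK K X = (SOME k. \<exists>B. B \<subseteq> X \<and> lin_indep K B \<and> span K B = X \<and> card B = k)"

text \<open>The subfield F_q of F_{q^t}: the unique subfield of order q.\<close>
definition subfieldq :: "nat \<Rightarrow> 'a::field set" where
  "subfieldq q = {x. x ^ q = x}"

definition proj_points :: "('i \<Rightarrow> 'a::field) set set" where
  "proj_points = {span UNIV {v} | v. v \<noteq> vzero}"

definition proj_line :: "('i \<Rightarrow> 'a::field) set \<Rightarrow> bool" where
  "proj_line X \<longleftrightarrow> subsp UNIV X \<and> dimK UNIV X = 2"

definition linset :: "('i \<Rightarrow> 'a::field) set \<Rightarrow> ('i \<Rightarrow> 'a) set set" where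
  "linset U = {span UNIV {u} | u. u \<in> U \<and> u \<noteq> vzero}"

definition weight :: "nat \<Rightarrow> ('i \<Rightarrow> 'a::field) set \<Rightarrow> ('i \<Rightarrow> 'a) set \<Rightarrow> nat" where
  "weight q U W = dimK (subfieldq q) (W \<inter> U)"

definition scattered :: "nat \<Rightarrow> ('i \<Rightarrow> 'a::field) set \<Rightarrow> bool" where
  "scattered q U \<longleftrightarrow> (\<forall>P\<in>linset U. weight q U P = 1)"

definition pseudoregulus_type ::
    "nat \<Rightarrow> nat \<Rightarrow> nat \<Rightarrow> ('i \<Rightarrow> 'a::field) set set \<Rightarrow> bool" where
  "pseudoregulus_type q t n L \<longleftrightarrow>
     (\<exists>U. subsp (subfieldq q) U \<and> L = linset U \<and> scattered q U
        \<and> dimK (subfieldq q) U = t * n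
        \<and> (\<exists>S. card S = (q ^ (n * t) - 1) div (q ^ t - 1)
              \<and> (\<forall>s\<in>S. proj_line s \<and> weight q U s = t)
              \<and> (\<forall>s\<in>S. \<forall>s'\<in>S. s \<noteq> s' \<longrightarrow> s \<inter> s' = {vzero})
              \<and> card {T. subsp UNIV T \<and> dimK UNIV T = n
                        \<and> (\<forall>P\<in>L. \<not> P \<subseteq> T)
                        \<and> (\<forall>s\<in>S. s \<inter> T \<noteq> {vzero})} = 2))"

definition collineation :: "(('i \<Rightarrow> 'a::field) set \<Rightarrow> ('i \<Rightarrow> 'a) set) \<Rightarrow> bool" where
  "collineation f \<longleftrightarrow> bij_betw f proj_points proj_points \<and>
     (\<forall>P\<in>proj_points. \<forall>Q\<in>proj_points. \<forall>R\<in>proj_points.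
        R \<subseteq> span UNIV (P \<union> Q) \<longleftrightarrow> f R \<subseteq> span UNIV (f P \<union> f Q))"

definition coll_equiv :: "('i \<Rightarrow> 'a::field) set set set \<Rightarrow> (('i \<Rightarrow> 'a) set set \<times> ('i \<Rightarrow> 'a) set set) set" where
  "coll_equiv A = {(L, L'). L \<in> A \<and> L' \<in> A \<and> (\<exists>f. collineation f \<and> f ` L = L')}"

end

theory Submission
  imports Defs "HOL-Number_Theory.Residues" "HOL-Computational_Algebra.Polynomial"
    "HOL-Library.Function_Algebras"
begin

text \<open>
  Write \<open>Q = q^t\<close>.  Let \<open>L = L_U\<close> be of pseudoregulus type with lines \<open>s_i\<close> and transversal
  spaces \<open>T1\<close>, \<open>T2\<close>.  Counting gives \<open>V = T1 \<oplus> T2\<close> and shows that \<open>U\<close> is the graph \<open>{x + g x}\<close>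
  of an additive bijection \<open>g : T1 \<rightarrow> T2\<close>; the \<open>s_i\<close> are the lines \<open>\<langle>x, g x\<rangle>\<close>, so \<open>g\<close> maps points to
  points and is therefore semilinear.  Since \<open>L\<close> is scattered, the fixed field of its companion
  automorphism is exactly \<open>F_q\<close>, i.e. the automorphism is \<open>c \<mapsto> c^{q^i}\<close> with \<open>gcd i t = 1\<close>.

  Conversely each such graph is of pseudoregulus type, and two graphs with the same exponent are
  linearly equivalent.  Exchanging \<open>T1\<close> and \<open>T2\<close> turns \<open>i\<close> into \<open>t - i\<close>.  Nothing else can happen: as
  \<open>t \<ge> 3\<close>, the \<open>s_i\<close> are exactly the lines with more than \<open>q + 1\<close> points of \<open>L\<close>, so \<open>L\<close> determines
  \<open>{T1, T2}\<close> and the point map induced by \<open>g\<close>; and collineations are semilinear by the fundamental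
  theorem of projective geometry, while automorphisms of a finite field commute with powers.  Hence
  the orbits correspond to the pairs \<open>{i, t - i}\<close> with \<open>gcd i t = 1\<close>.
\<close>

subsection \<open>Finite fields and their automorphisms\<close>

text \<open>The point set \<open>L\<close> does not carry \<open>U\<close>, its lines or its
  transversal spaces along with it: in the definition they are bound by existential quantifiers or
  only counted. An exponent can therefore not be attached to \<open>L\<close> by a choice.
  \<open>has_type i L\<close> says that some graph with exponent \<open>i\<close> defines
  \<open>L\<close>, and the orbit invariant is the set of all such \<open>i\<close>.

  For the same reason the lines must be recovered from \<open>L\<close> by counting points on lines,
  and the transversal spaces from the lines alone. The second recovery rests on non-linearity: a
  third transversal space would make \<open>c \<mapsto> c^(q^i)\<close> the identity.

  Dimensions enter through \<open>card X = card K ^ d\<close>. As everything is finite, direct sums,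
  coverings and equalities of subspaces become comparisons of cardinalities. The hypothesis
  \<open>n \<ge> 2\<close> gives each transversal space two independent vectors, without which
  additive point maps could not be recognised as semilinear, and makes the projective dimension
  large enough for the fundamental theorem.\<close>

lemma multiplicative_generator:
  obtains a :: "'a::{finite,field}" where "a \<noteq> 0" "\<And>x. x \<noteq> 0 \<Longrightarrow> \<exists>k. x = a ^ k"
proof -
  \<comment> \<open>Cyclicity of the multiplicative group is a theorem about record-based rings, so
    the type is repackaged as one.\<close>
  define R :: "'a ring" where "R = \<lparr>carrier = UNIV, mult = (*), one = 1, zero = 0, add = (+)\<rparr>"
  have R: "carrier R = UNIV" "\<And>x y. x \<otimes>\<^bsub>R\<^esub> y = x * y" "\<one>\<^bsub>R\<^esub> = 1" "\<zero>\<^bsub>R\<^esub> = 0"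
      "\<And>x y. x \<oplus>\<^bsub>R\<^esub> y = x + y"
    by (simp_all add: R_def)
  have "cring R"
  proof (intro cringI abelian_groupI comm_monoidI)
    fix x :: 'a
    show "\<exists>y\<in>carrier R. y \<oplus>\<^bsub>R\<^esub> x = \<zero>\<^bsub>R\<^esub>"
      by (auto simp: R intro: exI[of _ "-x"])
  qed (simp_all add: R algebra_simps)
  then have "field R"
  proof (rule cring.cring_fieldI2)
    fix a assume "a \<noteq> \<zero>\<^bsub>R\<^esub>"
    then show "\<exists>b\<in>carrier R. a \<otimes>\<^bsub>R\<^esub> b = \<one>\<^bsub>R\<^esub>"
      by (intro bexI[of _ "inverse a"]) (simp_all add: R)
  qed (simp add: R)
  then interpret field R .
  obtain a where a: "a \<in> carrier (mult_of R)"
      "carrier (mult_of R) = {a [^]\<^bsub>R\<^esub> i | i::nat. i \<in> UNIV}"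
    using finite_field_mult_group_has_gen by auto
  have pw: "x [^]\<^bsub>R\<^esub> i = x ^ i" for x and i :: nat
    by (induction i) (simp_all add: R nat_pow_Suc)
  show thesis
  proof (rule that[of a])
    show "a \<noteq> 0" using a(1) by (simp add: R carrier_mult_of)
    show "\<exists>k. x = a ^ k" if "x \<noteq> 0" for x
    proof -
      have "x \<in> carrier (mult_of R)" using that by (simp add: carrier_mult_of R)
      then show ?thesis unfolding a(2) pw by auto
    qed
  qed
qed

lemma power_card_eq_self:
  fixes x :: "'a::{finite,field}"
  shows "x ^ card (UNIV :: 'a set) = x"
proof (cases "x = 0")
  case False
  \<comment> \<open>Multiplication by \<open>x\<close> permutes the nonzero elements; cancelling
    their product leaves the power of \<open>x\<close>.\<close>
  have "(\<Prod>y\<in>UNIV-{0}. x * y) = (\<Prod>y\<in>UNIV-{0}. y)"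
    by (rule prod.reindex_bij_witness[of _ "\<lambda>y. y / x" "\<lambda>y. x * y"]) (use False in auto)
  moreover have "(\<Prod>y\<in>UNIV-{0::'a}. y) \<noteq> 0" by simp
  ultimately have "x ^ (card (UNIV :: 'a set) - 1) = 1"
    by (simp add: prod.distrib)
  moreover have "card (UNIV :: 'a set) > 0" by (simp add: finite_UNIV_card_ge_0)
  ultimately show ?thesis
    by (metis Suc_diff_1 mult.right_neutral power_Suc)
qed (simp add: finite_UNIV_card_ge_0)

locale field_ext =
  fixes q t :: nat and TY :: "'a::{finite,field} itself"
  assumes q_primepow: "\<exists>p e. prime p \<and> e > 0 \<and> q = p ^ e"
    and card_field: "card (UNIV :: 'a set) = q ^ t"
    and t_ge_3: "t \<ge> 3"
begin

lemma q_ge_2: "q \<ge> 2"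
proof -
  obtain p e where "prime p" "e > 0" "q = p ^ e" using q_primepow by blast
  then show ?thesis
    by (metis One_nat_def Suc_leI nat_less_le one_less_power prime_gt_1_nat numeral_2_eq_2)
qed

lemma frob_add: "(x + y :: 'a) ^ (q ^ i) = x ^ (q ^ i) + y ^ (q ^ i)"
proof -
  obtain p e where pe: "prime p" "e > 0" "q = p ^ e" using q_primepow by blast
  have "CHAR('a) > 0" by (rule finite_imp_CHAR_pos) simp
  then have pr: "prime CHAR('a)" by (rule prime_CHAR_semidom)
  moreover have "CHAR('a) dvd p ^ (e * t)"
    using CHAR_dvd_CARD[where 'a='a] by (simp add: card_field pe power_mult)
  ultimately have "CHAR('a) = p"
    using pe(1) by (metis prime_dvd_power primes_dvd_imp_eq)
  then have "q ^ i = CHAR('a) ^ (e * i)" by (simp add: pe power_mult)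
  then show ?thesis by (rule freshmans_dream'[OF pr])
qed

lemma frob_zero: "(0::'a) ^ (q ^ i) = 0"
  using q_ge_2 by simp

lemma frob_frob: "((x::'a) ^ (q ^ i)) ^ (q ^ j) = x ^ (q ^ (i + j))"
  by (simp add: power_add power_mult)

lemma frob_t: "(x::'a) ^ (q ^ t) = x"
  using power_card_eq_self[of x] by (simp add: card_field)

lemma frob_mult_t: "(x::'a) ^ (q ^ (t * k)) = x"
proof (induction k)
  case (Suc k)
  then show ?case by (metis frob_frob frob_t mult_Suc_right)
qed simp

text \<open>The exponent \<open>i * (t - 1)\<close> is chosen because it adds up with
  \<open>i\<close> to a multiple of \<open>t\<close>; it inverts the map for every \<open>i\<close>,
  also beyond \<open>t\<close>.\<close>

lemma frob_inv: "((x::'a) ^ (q ^ i)) ^ (q ^ (i * (t - 1))) = x"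
proof -
  have "i + i * (t - 1) = t * i"
    using t_ge_3 by (cases t) simp_all
  then show ?thesis by (simp add: frob_frob frob_mult_t)
qed

lemma frob_inj: "(x::'a) ^ (q ^ i) = y ^ (q ^ i) \<Longrightarrow> x = y"
  by (metis frob_inv)

lemma frob_surj: "\<exists>y. (y::'a) ^ (q ^ i) = x"
  using frob_inv[of x i] by (metis power_mult mult.commute)

lemma frob_iter_fix: "(x::'a) ^ (q ^ i) = x \<Longrightarrow> x ^ (q ^ (i * k)) = x"
proof (induction k)
  case (Suc k)
  then show ?case by (metis frob_frob mult_Suc_right)
qed simp

text \<open>By Bezout, \<open>i * a = t * b + 1\<close> for some \<open>a\<close> and
  \<open>b\<close>. An element fixed by the \<open>i\<close>-th Frobenius power is fixed by its
  \<open>a\<close>-th iterate, which equals the Frobenius map itself.\<close>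

lemma frob_fix_iff:
  assumes "coprime i t"
  shows "(x::'a) ^ (q ^ i) = x \<longleftrightarrow> x \<in> subfieldq q"
proof
  assume x: "x ^ (q ^ i) = x"
  show "x \<in> subfieldq q"
  proof (cases "i = 0")
    case True
    then show ?thesis using assms t_ge_3 by simp
  next
    case False
    then obtain a b where "i * a = t * b + 1"
      using bezout_nat[of i t] assms by (auto simp: coprime_iff_gcd_eq_1)
    then have "x ^ (q ^ (t * b + 1)) = x" using frob_iter_fix[OF x, of a] by simp
    moreover have "x ^ (q ^ (t * b + 1)) = x ^ q"
      by (metis frob_frob frob_mult_t power_one_right)
    ultimately show ?thesis by (simp add: subfieldq_def)
  qed
next
  assume "x \<in> subfieldq q"
  then show "x ^ (q ^ i) = x"
    using frob_iter_fix[of x 1 i] by (simp add: subfieldq_def)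
qed

text \<open>Exponents reduce modulo \<open>q ^ t - 1\<close>, so that many powers already exhaust
  equally many nonzero elements and no two of them can coincide.\<close>

lemma generator_order:
  assumes "a \<noteq> (0::'a)" "\<And>x. x \<noteq> 0 \<Longrightarrow> \<exists>k. x = a ^ k"
  shows "inj_on (\<lambda>k. a ^ k) {..<q ^ t - 1}"
proof -
  let ?N = "q ^ t - 1"
  have N: "?N > 0" using q_ge_2 t_ge_3
    by (metis One_nat_def Suc_1 Suc_le_lessD gr0I not_numeral_le_zero one_less_power zero_less_diff)
  have "Suc ?N = q ^ t" using N by simp
  then have "a * a ^ ?N = a" using frob_t[of a] by (metis power_Suc)
  then have a1: "a ^ ?N = 1" using assms(1) by simp
  have "a ^ k = a ^ (k mod ?N)" for k
  proof -
    have "a ^ k = a ^ (?N * (k div ?N) + k mod ?N)" by (simp only: mult_div_mod_eq)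
    also have "\<dots> = a ^ (k mod ?N)" by (simp only: power_add power_mult a1) simp
    finally show ?thesis .
  qed
  moreover have "k mod ?N \<in> {..<?N}" for k using N by simp
  ultimately have "UNIV - {0} \<subseteq> (\<lambda>k. a ^ k) ` {..<?N}"
    using assms(2) by (metis Diff_iff imageI insertCI subsetI)
  then have "card (UNIV - {0::'a}) \<le> card ((\<lambda>k. a ^ k) ` {..<?N})"
    by (intro card_mono) auto
  then have "card ((\<lambda>k. a ^ k) ` {..<?N}) = card {..<?N}"
    using card_image_le[of "{..<?N}" "\<lambda>k. a ^ k"] by (simp add: card_field card_Diff_singleton)
  then show ?thesis by (intro eq_card_imp_inj_on) auto
qed

text \<open>The roots of \<open>X^m - X\<close> give the upper bound. For the lower bound, zero and
  the powers of a generator whose exponents are multiples of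
  \<open>c = (q ^ t - 1) / (m - 1)\<close> are fixed.\<close>

lemma card_power_fixed:
  assumes m2: "m \<ge> 2" and dvd: "(m - 1) dvd (q ^ t - 1)"
  shows "card {x::'a. x ^ m = x} = m"
proof (rule antisym)
  let ?p = "monom 1 m - monom 1 1 :: 'a poly"
  have "coeff ?p m = 1" using m2 by simp
  then have nz: "?p \<noteq> 0" by (metis coeff_0 zero_neq_one)
  have "{x. x ^ m = x} = {x. poly ?p x = 0}"
    by (auto simp: poly_monom)
  moreover have "degree ?p \<le> m"
    using m2 by (intro degree_diff_le) (auto intro: order_trans[OF degree_monom_le])
  ultimately show "card {x::'a. x ^ m = x} \<le> m"
    using card_poly_roots_bound[OF nz] by simp
next
  obtain a :: 'a where a: "a \<noteq> 0" "\<And>x. x \<noteq> 0 \<Longrightarrow> \<exists>k. x = a ^ k"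
    using multiplicative_generator by metis
  obtain c where c: "q ^ t - 1 = (m - 1) * c" using dvd by blast
  have "q ^ t > 1" using q_ge_2 t_ge_3 by (intro one_less_power) auto
  then have c0: "c > 0" using c by (cases c) auto
  have "Suc (q ^ t - 1) = q ^ t" using \<open>q ^ t > 1\<close> by simp
  then have "a * a ^ (q ^ t - 1) = a" using frob_t[of a] by (metis power_Suc)
  then have aN: "a ^ (q ^ t - 1) = 1" using a(1) by simp
  let ?f = "\<lambda>k. a ^ (c * k)"
  have inj: "inj_on ?f {..<m - 1}"
  proof (rule inj_onI)
    fix x y assume xy: "x \<in> {..<m - 1}" "y \<in> {..<m - 1}" "?f x = ?f y"
    then have "c * x \<in> {..<q ^ t - 1}" "c * y \<in> {..<q ^ t - 1}" unfolding c
      using c0 by (simp_all add: mult.commute)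
    then have "c * x = c * y" using generator_order[OF a] xy(3) by (meson inj_onD)
    then show "x = y" using c0 by simp
  qed
  have "insert 0 (?f ` {..<m - 1}) \<subseteq> {x. x ^ m = x}"
  proof -
    have "a ^ (c * k * m) = a ^ (c * k)" for k
    proof -
      have "c * k * m = (q ^ t - 1) * k + c * k"
        using m2 unfolding c by (cases m) (simp_all add: algebra_simps)
      then show ?thesis by (simp only: power_add power_mult[of a "q ^ t - 1"] aN power_one mult_1)
    qed
    then show ?thesis using m2 by (auto simp flip: power_mult)
  qed
  then have "card (insert 0 (?f ` {..<m - 1})) \<le> card {x::'a. x ^ m = x}"
    by (intro card_mono) auto
  moreover have "card (insert 0 (?f ` {..<m - 1})) = m"
    using inj a(1) m2 by (subst card_insert_disjoint) (auto simp: card_image)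
  ultimately show "m \<le> card {x::'a. x ^ m = x}" by simp
qed

lemma card_frob_fixed:
  assumes "d dvd t" "d > 0"
  shows "card {x::'a. x ^ (q ^ d) = x} = q ^ d"
proof (rule card_power_fixed)
  have "q ^ 1 \<le> q ^ d" using assms q_ge_2 by (intro power_increasing) auto
  then show "2 \<le> q ^ d" using q_ge_2 by simp
  obtain l where l: "t = d * l" using assms by blast
  have "int (q ^ d) - 1 dvd int (q ^ d) ^ l - 1"
    by (metis dvd_triv_left power_diff_1_eq)
  then have "int (q ^ d - 1) dvd int (q ^ t - 1)"
    using q_ge_2 by (simp add: l power_mult of_nat_diff)
  then show "(q ^ d - 1) dvd (q ^ t - 1)" by (simp only: int_dvd_int_iff)
qed

lemma card_subfieldq: "card (subfieldq q :: 'a set) = q"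
  using card_frob_fixed[of 1] by (simp add: subfieldq_def)

text \<open>Evaluate at a generator: both exponents \<open>q ^ i\<close> and \<open>q ^ j\<close>
  lie below its order \<open>q ^ t - 1\<close>, so they are equal.\<close>

lemma frob_eq_imp_eq:
  assumes "\<And>x::'a. x ^ (q ^ i) = x ^ (q ^ j)" "i < t" "j < t"
  shows "i = j"
proof -
  obtain a :: 'a where a: "a \<noteq> 0" "\<And>x. x \<noteq> 0 \<Longrightarrow> \<exists>k. x = a ^ k"
    using multiplicative_generator by metis
  have lt: "q ^ k < q ^ t - 1" if "k < t" for k
  proof -
    obtain t' where t': "t = Suc t'" "t' \<ge> 1" using t_ge_3 by (cases t) auto
    have "q ^ k \<le> q ^ t'" using that t' q_ge_2 by (intro power_increasing) auto
    moreover have "q ^ 1 \<le> q ^ t'" using t' q_ge_2 by (intro power_increasing) auto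
    moreover have "2 * q ^ t' \<le> q * q ^ t'" using q_ge_2 by (intro mult_right_mono) auto
    ultimately show ?thesis using q_ge_2 t' by (simp, linarith)
  qed
  have "q ^ i = q ^ j"
    using inj_onD[OF generator_order[OF a] assms(1)[of a]] lt assms(2,3) by simp
  then show ?thesis using q_ge_2 by simp
qed

text \<open>The coefficients of the orbit polynomial of a generator lie in the fixed field, so an
  automorphism permutes its roots, which are the Frobenius conjugates.\<close>
lemma automorphism_is_frob:
  fixes s :: "'a \<Rightarrow> 'a"
  assumes add: "\<And>x y. s (x + y) = s x + s y" and mult: "\<And>x y. s (x * y) = s x * s y"
    and one: "s 1 = 1"
    and fix_iff: "\<And>x. s x = x \<longleftrightarrow> x \<in> subfieldq q"
  obtains i where "i \<in> totatives t" "\<And>x. s x = x ^ (q ^ i)"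
proof -
  have zero: "s 0 = 0" using add[of 0 0] by (metis add_cancel_right_left add_0)
  have pow: "s (x ^ k) = s x ^ k" for x k by (induction k) (simp_all add: one mult)
  obtain a :: 'a where a: "a \<noteq> 0" "\<And>x. x \<noteq> 0 \<Longrightarrow> \<exists>k. x = a ^ k"
    using multiplicative_generator by metis
  define P :: "'a poly" where "P = (\<Prod>i<t. [:- (a ^ (q ^ i)), 1:])"
  have frob_minus: "(- x :: 'a) ^ q = - (x ^ q)" for x
    using frob_add[of x "-x" 1] frob_zero[of 1] by (simp add: eq_neg_iff_add_eq_0 add.commute)
  have frob_map_mult: "map_poly (\<lambda>x. x ^ q) (f * g) = map_poly (\<lambda>x. x ^ q) f * map_poly (\<lambda>x. x ^ q) g"
    for f g :: "'a poly"
  proof (rule poly_eqI)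
    fix n
    have z: "(0::'a) ^ q = 0" using frob_zero[of 1] by simp
    have sm: "(sum h A) ^ q = (\<Sum>x\<in>A. h x ^ q)" for h :: "nat \<Rightarrow> 'a" and A
      using frob_add[of _ _ 1] z by (induction A rule: infinite_finite_induct) simp_all
    show "coeff (map_poly (\<lambda>x. x ^ q) (f * g)) n = coeff (map_poly (\<lambda>x. x ^ q) f * map_poly (\<lambda>x. x ^ q) g) n"
      by (simp add: coeff_map_poly z coeff_mult sm power_mult_distrib)
  qed
  have "map_poly (\<lambda>x. x ^ q) (\<Prod>i<k. [:- (a ^ (q ^ i)), 1:]) = (\<Prod>i<k. [:- (a ^ (q ^ Suc i)), 1:])" for k
  proof (induction k)
    case 0
    then show ?case by (simp add: map_poly_1')
  next
    case (Suc k)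
    have "map_poly (\<lambda>x. x ^ q) [:- (a ^ (q ^ k)), 1:] = [:- (a ^ (q ^ Suc k)), 1:]"
      using frob_zero[of 1] by (simp add: map_poly_pCons frob_minus flip: power_mult) (simp add: mult.commute)
    then show ?case using Suc by (simp only: prod.lessThan_Suc frob_map_mult)
  qed
  then have "map_poly (\<lambda>x. x ^ q) P = (\<Prod>i<t. [:- (a ^ (q ^ Suc i)), 1:])"
    unfolding P_def .
  \<comment> \<open>The shift of the factors is cyclic: \<open>a ^ (q ^ t) = a\<close>, so the last
    shifted factor is the first factor of \<open>P\<close>.\<close>
  also have "\<dots> = P"
  proof -
    obtain t' where t': "t = Suc t'" using t_ge_3 by (cases t) auto
    show ?thesis unfolding P_def t'
      by (subst prod.lessThan_Suc, subst prod.lessThan_Suc_shift)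
        (use frob_t[of a] t' in \<open>simp add: mult.commute\<close>)
  qed
  finally have "coeff P n ^ q = coeff P n" for n
    using frob_zero[of 1] by (metis coeff_map_poly power_one_right)
  then have fixP: "s (coeff P n) = coeff P n" for n
    using fix_iff by (simp add: subfieldq_def)
  have ssum: "s (sum h A) = (\<Sum>x\<in>A. s (h x))" for h :: "nat \<Rightarrow> 'a" and A
    by (induction A rule: infinite_finite_induct) (simp_all add: zero add)
  have "poly P (s a) = s (poly P a)"
    by (simp add: poly_altdef ssum mult pow fixP)
  also have "poly P a = 0"
  proof -
    have "(0::nat) \<in> {..<t}" using t_ge_3 by simp
    moreover have "poly [:- (a ^ (q ^ 0)), 1:] a = 0" by simp
    ultimately show ?thesis unfolding P_def poly_prod by (meson finite_lessThan prod_zero)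
  qed
  finally have "poly P (s a) = 0" by (simp add: zero)
  then obtain i where i: "i < t" "s a = a ^ (q ^ i)"
    unfolding P_def poly_prod by (auto simp: prod_zero_iff)
  have s: "s x = x ^ (q ^ i)" for x
  proof (cases "x = 0")
    case True
    then show ?thesis by (simp add: zero frob_zero)
  next
    case False
    then obtain k where "x = a ^ k" using a(2) by blast
    then show ?thesis by (simp add: pow i mult.commute flip: power_mult)
  qed
  \<comment> \<open>With \<open>d = gcd i t > 1\<close> all \<open>q ^ d\<close> solutions of
    \<open>x ^ (q ^ d) = x\<close> would be fixed by \<open>s\<close>, more than the
    \<open>q\<close> elements of its fixed field.\<close>
  have "coprime i t"
  proof (rule ccontr)
    assume "\<not> coprime i t"
    then have g: "gcd i t \<noteq> 1" by (simp add: coprime_iff_gcd_eq_1)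
    define d where "d = gcd i t"
    obtain k where k: "i = d * k" unfolding d_def by (metis dvdE gcd_dvd1)
    have d: "d dvd t" "d > 1"
      using g t_ge_3 unfolding d_def
      by (simp, metis gcd_eq_0_iff not_numeral_le_zero nat_neq_iff less_one)
    have sub: "{x::'a. x ^ (q ^ d) = x} \<subseteq> subfieldq q"
      using frob_iter_fix[of _ d k] by (auto simp: s k simp flip: fix_iff)
    then have "q ^ d \<le> q ^ 1"
      using card_mono[OF _ sub] card_frob_fixed[of d] d card_subfieldq by simp
    then show False using d(2) q_ge_2 by (subst (asm) power_increasing_iff) auto
  qed
  moreover have "i > 0" using \<open>coprime i t\<close> t_ge_3 by (cases i) auto
  ultimately have "i \<in> totatives t" using i(1) by (auto simp: totatives_def)
  then show thesis using s that by blast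
qed

end

subsection \<open>Subspaces over a subfield and their cardinalities\<close>

notation smul (infixr "*s" 75)

interpretation V: vector_space "smul :: 'a::field \<Rightarrow> ('i \<Rightarrow> 'a) \<Rightarrow> ('i \<Rightarrow> 'a)"
  by unfold_locales (auto simp: smul_def fun_eq_iff algebra_simps)

lemma smul_apply [simp]: "(c *s v) i = c * v i"
  by (simp add: smul_def)

lemma sum_fun_apply: "(\<Sum>b\<in>B. f b) i = (\<Sum>b\<in>B. f b i)"
  by (induction B rule: infinite_finite_induct) auto

lemma vadd_eq_plus: "vadd = (+)"
  by (auto simp: vadd_def fun_eq_iff)

lemma vzero_eq_0: "vzero = 0"
  by (auto simp: vzero_def fun_eq_iff)

lemma subsp_iff:
  "subsp K X \<longleftrightarrow> 0 \<in> X \<and> (\<forall>u\<in>X. \<forall>v\<in>X. u + v \<in> X) \<and> (\<forall>c\<in>K. \<forall>v\<in>X. c *s v \<in> X)"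
  by (simp add: subsp_def vadd_eq_plus vzero_eq_0)

lemma subsp_UNIV_eq: "subsp UNIV = V.subspace"
  by (auto simp: subsp_iff V.subspace_def fun_eq_iff)

lemma span_UNIV_eq: "span UNIV = V.span"
  by (auto simp: span_def V.span_def hull_def subsp_UNIV_eq fun_eq_iff)

lemma in_span_singleton: "x \<in> V.span {u} \<longleftrightarrow> (\<exists>a. x = a *s u)"
  by (auto simp: V.span_singleton)

lemma in_span_pair: "x \<in> V.span {u, v} \<longleftrightarrow> (\<exists>a b. x = a *s u + b *s v)"
proof
  assume "x \<in> V.span {u, v}"
  then obtain a where "x - a *s u \<in> V.span {v}" by (auto simp: V.span_breakdown_eq)
  then obtain b where "x - a *s u = b *s v" by (auto simp: V.span_singleton)
  then show "\<exists>a b. x = a *s u + b *s v" by (metis add.commute diff_add_cancel)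
next
  assume "\<exists>a b. x = a *s u + b *s v"
  moreover have "u \<in> V.span {u, v}" "v \<in> V.span {u, v}" by (simp_all add: V.span_base)
  ultimately show "x \<in> V.span {u, v}" using V.span_add V.span_scale by metis
qed

lemma indep2_coeffs:
  assumes "u \<noteq> 0" "v \<notin> V.span {u}" "a *s u + b *s v = a' *s u + b' *s v"
  shows "a = a'" "b = b'"
proof -
  have *: "(b - b') *s v = (a' - a) *s u"
  proof
    fix i
    have "a * u i + b * v i = a' * u i + b' * v i" using fun_cong[OF assms(3), of i] by simp
    moreover have "(b - b') * v i - (a' - a) * u i = (a * u i + b * v i) - (a' * u i + b' * v i)"
      by (simp add: algebra_simps)
    ultimately have "(b - b') * v i = (a' - a) * u i" by simp
    then show "((b - b') *s v) i = ((a' - a) *s u) i" by simp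
  qed
  show "b = b'"
  proof (rule ccontr)
    assume "b \<noteq> b'"
    then have "v = inverse (b - b') *s ((b - b') *s v)" by simp
    also have "\<dots> = (inverse (b - b') * (a' - a)) *s u" by (simp only: * V.scale_scale)
    finally show False using assms(2) in_span_singleton by blast
  qed
  then show "a = a'" using * assms(1) by simp
qed

lemma indep3_coeffs:
  assumes "u \<noteq> 0" "v \<notin> V.span {u}" "w \<notin> V.span {u, v}"
    "a *s u + b *s v + c *s w = a' *s u + b' *s v + c' *s w"
  shows "a = a'" "b = b'" "c = c'"
proof -
  have *: "(c - c') *s w = (a' - a) *s u + (b' - b) *s v"
  proof
    fix i
    have "a * u i + b * v i + c * w i = a' * u i + b' * v i + c' * w i"
      using fun_cong[OF assms(4), of i] by simp
    moreover have "(c - c') * w i - ((a' - a) * u i + (b' - b) * v i)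
        = (a * u i + b * v i + c * w i) - (a' * u i + b' * v i + c' * w i)"
      by (simp add: algebra_simps)
    ultimately have "(c - c') * w i = (a' - a) * u i + (b' - b) * v i" by simp
    then show "((c - c') *s w) i = ((a' - a) *s u + (b' - b) *s v) i" by simp
  qed
  show c: "c = c'"
  proof (rule ccontr)
    assume "c \<noteq> c'"
    then have "w = inverse (c - c') *s ((c - c') *s w)" by simp
    then have "w \<in> V.span {u, v}"
      unfolding * by (metis V.span_scale in_span_pair)
    then show False using assms(3) by blast
  qed
  then have eq: "a *s u + b *s v = a' *s u + b' *s v" using assms(4) by simp
  show "a = a'" "b = b'" using indep2_coeffs[OF assms(1,2) eq] by simp_all
qed

lemma span_singleton_eq_iff:
  assumes "u \<noteq> 0" "v \<noteq> 0"
  shows "V.span {u} = V.span {v} \<longleftrightarrow> u \<in> V.span {v}"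
proof
  assume "u \<in> V.span {v}"
  then obtain c where c: "u = c *s v" by (auto simp: in_span_singleton)
  then have "c \<noteq> 0" using assms by auto
  then have "v = inverse c *s u" by (simp add: c)
  then have "v \<in> V.span {u}" by (metis V.span_base V.span_scale singletonI)
  then show "V.span {u} = V.span {v}"
    using \<open>u \<in> V.span {v}\<close> by (simp add: V.span_eq)
next
  show "V.span {u} = V.span {v} \<Longrightarrow> u \<in> V.span {v}"
    using V.span_base[of u "{u}"] by simp
qed

text \<open>Turns the incidence condition of \<open>collineation\<close> into a condition on
  representing vectors. The case \<open>p = s\<close> is included and later yields that
  proportionality is preserved.\<close>

lemma span_pair_subset_iff:
  "V.span {r} \<subseteq> V.span (V.span {p} \<union> V.span {s}) \<longleftrightarrow> r \<in> V.span {p, s}"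
proof -
  have "V.span (V.span {p} \<union> V.span {s}) = V.span {p, s}"
  proof (rule antisym)
    have "V.span {p} \<subseteq> V.span {p, s}" "V.span {s} \<subseteq> V.span {p, s}"
      by (rule V.span_mono, simp)+
    then show "V.span (V.span {p} \<union> V.span {s}) \<subseteq> V.span {p, s}"
      by (intro V.span_minimal) auto
    have "p \<in> V.span {p}" "s \<in> V.span {s}" by (simp_all add: V.span_base)
    then show "V.span {p, s} \<subseteq> V.span (V.span {p} \<union> V.span {s})"
      by (intro V.span_mono) auto
  qed
  moreover have "V.span {r} \<subseteq> V.span {p, s} \<longleftrightarrow> r \<in> V.span {p, s}"
    using V.span_minimal[of "{r}" "V.span {p, s}"] V.span_base[of r "{r}"] by auto
  ultimately show ?thesis by simp
qed

lemma proj_points_iff: "P \<in> proj_points \<longleftrightarrow> (\<exists>v. v \<noteq> 0 \<and> P = V.span {v})"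
  by (auto simp: proj_points_def span_UNIV_eq vzero_eq_0)

lemma proj_pointsE:
  assumes "P \<in> proj_points"
  obtains v where "v \<noteq> 0" "P = V.span {v}"
  using assms unfolding proj_points_iff by (elim exE conjE)

lemma linset_eq: "linset U = (\<lambda>u. V.span {u}) ` (U - {0})"
  by (auto simp: linset_def span_UNIV_eq vzero_eq_0)

text \<open>Subfields are sets, not types, whereas the interpretation \<open>V\<close> speaks of the
  full field. Spans over \<open>K\<close> therefore get a small theory of their own, leading up to
  \<open>dimK_eq_iff\<close>.\<close>

definition subfield_set :: "'a::field set \<Rightarrow> bool" where
  "subfield_set K \<longleftrightarrow> 0 \<in> K \<and> 1 \<in> K \<and> (\<forall>x\<in>K. \<forall>y\<in>K. x + y \<in> K \<and> x * y \<in> K)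
     \<and> (\<forall>x\<in>K. - x \<in> K \<and> inverse x \<in> K)"

lemma subfield_set_UNIV: "subfield_set UNIV"
  by (simp add: subfield_set_def)

lemma subsp_span: "subsp K (span K B)"
  unfolding span_def subsp_iff by blast

lemma span_minimal_K: "B \<subseteq> X \<Longrightarrow> subsp K X \<Longrightarrow> span K B \<subseteq> X"
  unfolding span_def by blast

lemma span_superset_K: "B \<subseteq> span K B"
  unfolding span_def by blast

lemma subsp_sum:
  assumes "subsp K X" "\<And>b. b \<in> B \<Longrightarrow> f b \<in> X"
  shows "(\<Sum>b\<in>B. f b) \<in> X"
  using assms(2)
  by (induction B rule: infinite_finite_induct) (use assms(1) in \<open>auto simp: subsp_iff\<close>)

lemma lin_indep_iff:
  "lin_indep K B \<longleftrightarrow> finite B \<and> (\<forall>c\<in>B \<rightarrow> K. (\<Sum>b\<in>B. c b *s b) = 0 \<longrightarrow> (\<forall>b\<in>B. c b = 0))"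
proof -
  have "(\<forall>i. (\<Sum>b\<in>B. c b * b i) = 0) \<longleftrightarrow> (\<Sum>b\<in>B. c b *s b) = 0" for c
    by (simp add: fun_eq_iff sum_fun_apply)
  then show ?thesis by (auto simp: lin_indep_def Pi_def)
qed

lemma span_K_eq:
  assumes K: "subfield_set K" and "finite B"
  shows "span K B = (\<lambda>c. \<Sum>b\<in>B. c b *s b) ` (B \<rightarrow>\<^sub>E K)"
proof
  have "subsp K ((\<lambda>c. \<Sum>b\<in>B. c b *s b) ` (B \<rightarrow>\<^sub>E K))" (is "subsp K ?X")
  proof -
    have X: "(\<Sum>b\<in>B. c b *s b) \<in> ?X" if "c \<in> B \<rightarrow> K" for c
      using that by (intro image_eqI[of _ _ "restrict c B"]) (auto intro: sum.cong)
    show ?thesis unfolding subsp_iff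
    proof (intro conjI ballI)
      show "0 \<in> ?X" using X[of "\<lambda>_. 0"] K by (simp add: subfield_set_def)
    next
      fix u v assume "u \<in> ?X" "v \<in> ?X"
      then obtain c d where cd: "c \<in> B \<rightarrow> K" "d \<in> B \<rightarrow> K"
          "u = (\<Sum>b\<in>B. c b *s b)" "v = (\<Sum>b\<in>B. d b *s b)" by (auto simp: PiE_def)
      then have "u + v = (\<Sum>b\<in>B. (c b + d b) *s b)"
        by (simp add: V.scale_left_distrib sum.distrib)
      then show "u + v \<in> ?X" using X[of "\<lambda>b. c b + d b"] cd K by (auto simp: subfield_set_def Pi_def)
    next
      fix x u assume "x \<in> K" "u \<in> ?X"
      then obtain c where c: "c \<in> B \<rightarrow> K" "u = (\<Sum>b\<in>B. c b *s b)" by (auto simp: PiE_def)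
      then have "x *s u = (\<Sum>b\<in>B. (x * c b) *s b)" by (simp add: V.scale_sum_right)
      then show "x *s u \<in> ?X" using X[of "\<lambda>b. x * c b"] c \<open>x \<in> K\<close> K by (auto simp: subfield_set_def Pi_def)
    qed
  qed
  moreover have "B \<subseteq> ?X"
  proof
    fix b assume b: "b \<in> B"
    have "(\<Sum>x\<in>B. (if x = b then 1 else 0) *s x) = (\<Sum>x\<in>B. if x = b then x else 0)"
      by (intro sum.cong) auto
    also have "\<dots> = b" using assms(2) b by simp
    finally have "b = (\<Sum>x\<in>B. restrict (\<lambda>x. if x = b then 1 else 0) B x *s x)"
      by (simp cong: sum.cong)
    moreover have "restrict (\<lambda>x. if x = b then 1 else 0) B \<in> B \<rightarrow>\<^sub>E K"
      using K by (auto simp: subfield_set_def)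
    ultimately show "b \<in> ?X" by (rule image_eqI)
  qed
  ultimately show "span K B \<subseteq> ?X" by (intro span_minimal_K)
next
  show "(\<lambda>c. \<Sum>b\<in>B. c b *s b) ` (B \<rightarrow>\<^sub>E K) \<subseteq> span K B"
  proof (rule image_subsetI)
    fix c assume "c \<in> B \<rightarrow>\<^sub>E K"
    then have "c b *s b \<in> span K B" if b: "b \<in> B" for b
    proof -
      have "c b \<in> K" "b \<in> span K B"
        using b PiE_mem[OF \<open>c \<in> B \<rightarrow>\<^sub>E K\<close> b] span_superset_K[of B K] by blast+
      then show ?thesis using subsp_span[of K B] unfolding subsp_iff by blast
    qed
    then show "(\<Sum>b\<in>B. c b *s b) \<in> span K B" by (rule subsp_sum[OF subsp_span])
  qed
qed

lemma card_span_K: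
  assumes K: "subfield_set K" and B: "lin_indep K B"
  shows "card (span K B) = card K ^ card B"
proof -
  have fin: "finite B" using B by (simp add: lin_indep_def)
  have "inj_on (\<lambda>c. \<Sum>b\<in>B. c b *s b) (B \<rightarrow>\<^sub>E K)"
  proof (rule inj_onI)
    fix c d assume cd: "c \<in> B \<rightarrow>\<^sub>E K" "d \<in> B \<rightarrow>\<^sub>E K" "(\<Sum>b\<in>B. c b *s b) = (\<Sum>b\<in>B. d b *s b)"
    have "x - y \<in> K" if "x \<in> K" "y \<in> K" for x y
      using that K unfolding subfield_set_def by (metis uminus_add_conv_diff add.commute)
    then have "(\<lambda>b. c b - d b) \<in> B \<rightarrow> K" using cd by (auto simp: PiE_def)
    moreover have "(\<Sum>b\<in>B. (c b - d b) *s b) = 0"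
      using cd(3) by (simp add: V.scale_left_diff_distrib sum_subtractf)
    ultimately have "\<forall>b\<in>B. c b = d b" using B by (auto simp: lin_indep_iff)
    then show "c = d" using cd by (intro PiE_ext) auto
  qed
  then show ?thesis
    using fin by (simp add: span_K_eq[OF K fin] card_image card_PiE)
qed

text \<open>By finiteness there is a largest independent subset of \<open>X\<close>; a vector of
  \<open>X\<close> outside its span could be added to it.\<close>

lemma basis_exists_K:
  fixes X :: "('i::finite \<Rightarrow> 'a::{finite,field}) set"
  assumes K: "subfield_set K" and X: "subsp K X"
  obtains B where "B \<subseteq> X" "lin_indep K B" "span K B = X"
proof -
  have "lin_indep K ({} :: ('i \<Rightarrow> 'a) set)" by (simp add: lin_indep_def)
  then have "\<exists>B. (B \<subseteq> X \<and> lin_indep K B) \<and> (\<forall>B'. B' \<subseteq> X \<and> lin_indep K B' \<longrightarrow> card B' \<le> card B)"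
    by (intro ex_has_greatest_nat[where b="card (UNIV :: ('i \<Rightarrow> 'a) set) + 1" and k="{}"])
      (auto intro!: card_mono le_imp_less_Suc)
  then obtain B where B: "B \<subseteq> X" "lin_indep K B"
      "\<And>B'. B' \<subseteq> X \<Longrightarrow> lin_indep K B' \<Longrightarrow> card B' \<le> card B" by blast
  have fin: "finite B" by simp
  have "X \<subseteq> span K B"
  proof (rule ccontr)
    assume "\<not> X \<subseteq> span K B"
    then obtain v where v: "v \<in> X" "v \<notin> span K B" by blast
    then have vB: "v \<notin> B" using span_superset_K by blast
    have "lin_indep K (insert v B)" unfolding lin_indep_iff
    proof (intro conjI ballI impI)
      fix c b assume c: "c \<in> insert v B \<rightarrow> K" "(\<Sum>b\<in>insert v B. c b *s b) = 0" and b: "b \<in> insert v B"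
      then have eq: "c v *s v + (\<Sum>b\<in>B. c b *s b) = 0" using vB fin by simp
      have cv: "c v = 0"
      proof (rule ccontr)
        assume nz: "c v \<noteq> 0"
        have "v = inverse (c v) *s (c v *s v)" using nz by simp
        also have "c v *s v = - (\<Sum>b\<in>B. c b *s b)" using eq by (simp add: eq_neg_iff_add_eq_0)
        also have "inverse (c v) *s - (\<Sum>b\<in>B. c b *s b) = (\<Sum>b\<in>B. (- inverse (c v) * c b) *s b)"
          by (simp add: V.scale_sum_right sum_negf)
        also have "\<dots> \<in> span K B"
        proof (rule subsp_sum[OF subsp_span])
          fix b assume b: "b \<in> B"
          then have "- inverse (c v) * c b \<in> K" using c K by (auto simp: subfield_set_def)
          then show "(- inverse (c v) * c b) *s b \<in> span K B"
            using b subsp_span[of K B] span_superset_K[of B K] unfolding subsp_iff by blast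
        qed
        finally show False using v by blast
      qed
      then have "(\<Sum>b\<in>B. c b *s b) = 0" using eq by simp
      then show "c b = 0" using cv b B(2) c(1) by (auto simp: lin_indep_iff)
    qed simp
    then show False using B(3)[of "insert v B"] v B(1) vB by simp
  qed
  then show thesis using that[of B] B span_minimal_K[OF B(1) X] by blast
qed

lemma card_subfield_ge_2:
  fixes K :: "'a::{finite,field} set"
  assumes "subfield_set K" shows "card K \<ge> 2"
proof -
  have "card {0, 1::'a} \<le> card K" using assms by (intro card_mono) (auto simp: subfield_set_def)
  then show ?thesis by simp
qed

text \<open>\<open>dimK\<close> picks the size of some basis. Counting linear combinations shows
  that every basis has the size dictated by \<open>card X\<close>, so the choice is
  harmless.\<close>

lemma dimK_eq_iff:
  fixes X :: "('i::finite \<Rightarrow> 'a::{finite,field}) set"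
  assumes K: "subfield_set K" and X: "subsp K X"
  shows "dimK K X = d \<longleftrightarrow> card X = card K ^ d"
proof -
  obtain B where "B \<subseteq> X \<and> lin_indep K B \<and> span K B = X \<and> card B = card B"
    using basis_exists_K[OF assms] by metis
  then have "\<exists>k B. B \<subseteq> X \<and> lin_indep K B \<and> span K B = X \<and> card B = k" by blast
  then have "\<exists>B. B \<subseteq> X \<and> lin_indep K B \<and> span K B = X \<and> card B = dimK K X"
    unfolding dimK_def by (rule someI_ex)
  then have "card X = card K ^ dimK K X" using card_span_K[OF K] by metis
  then show ?thesis using card_subfield_ge_2[OF K] by auto
qed

text \<open>Connects cardinality with \<open>V.dim\<close>, in whose terms the isomorphism of
  subspaces used by \<open>has_type_equivalent\<close> is stated.\<close>

lemma card_subspace_eq_power_dim: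
  fixes X :: "('i::finite \<Rightarrow> 'a::{finite,field}) set"
  assumes "V.subspace X"
  shows "card X = card (UNIV :: 'a set) ^ V.dim X"
proof -
  obtain B where B: "B \<subseteq> X" "V.independent B" "X \<subseteq> V.span B" "card B = V.dim X"
    using V.basis_exists by blast
  then have "V.span B = X" using assms by (metis V.span_minimal subset_antisym)
  moreover have "lin_indep UNIV B"
    using V.independentD[OF B(2), of B] by (auto simp: lin_indep_iff)
  ultimately show ?thesis using card_span_K[OF subfield_set_UNIV, of B] B by (simp add: span_UNIV_eq)
qed

lemma card_span_singleton:
  fixes u :: "'i \<Rightarrow> 'a::{finite,field}"
  assumes "u \<noteq> 0"
  shows "card (V.span {u}) = card (UNIV :: 'a set)"
proof -
  have "inj (\<lambda>k. k *s u)" using assms by (auto intro!: injI)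
  then show ?thesis by (simp add: V.span_singleton card_image)
qed

lemma card_span_pair:
  fixes u :: "'i \<Rightarrow> 'a::{finite,field}"
  assumes "u \<noteq> 0" "v \<notin> V.span {u}"
  shows "card (V.span {u, v}) = card (UNIV :: 'a set) ^ 2"
proof -
  have "V.span {u, v} = (\<lambda>(a, b). a *s u + b *s v) ` UNIV"
    unfolding set_eq_iff in_span_pair image_iff by (simp add: split_paired_Ex split_paired_all) 
  moreover have "inj (\<lambda>(a, b). a *s u + b *s v)"
  proof (rule injI, clarsimp)
    fix a b a' b' assume "a *s u + b *s v = a' *s u + b' *s v"
    then show "a = a' \<and> b = b'" using indep2_coeffs[OF assms] by blast
  qed
  ultimately show ?thesis
    by (simp add: card_image card_cartesian_product power2_eq_square flip: UNIV_Times_UNIV)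
qed

section \<open>Collineations induced by linear bijections\<close>

lemma collineation_linear_image:
  fixes \<phi> :: "('i \<Rightarrow> 'a::field) \<Rightarrow> ('i \<Rightarrow> 'a)"
  assumes add: "\<And>u v. \<phi> (u + v) = \<phi> u + \<phi> v" and scale: "\<And>c v. \<phi> (c *s v) = c *s \<phi> v"
    and bij: "bij \<phi>"
  shows "collineation ((`) \<phi>)" and "(`) \<phi> ` linset U = linset (\<phi> ` U)"
proof -
  have zero: "\<phi> 0 = 0" using add[of 0 0] by simp
  have inj: "\<phi> u = \<phi> v \<longleftrightarrow> u = v" for u v using bij by (meson bij_is_inj injD)
  have nz: "\<phi> v = 0 \<longleftrightarrow> v = 0" for v using inj[of v 0] by (simp add: zero)
  have sp: "\<phi> ` V.span {v} = V.span {\<phi> v}" for v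
    by (simp add: V.span_singleton image_image scale)
  have pair: "\<phi> r \<in> V.span {\<phi> p, \<phi> s} \<longleftrightarrow> r \<in> V.span {p, s}" for p r s
    by (simp add: in_span_pair inj flip: scale add)
  show "collineation ((`) \<phi>)" unfolding collineation_def
  proof (intro conjI ballI)
    show "bij_betw ((`) \<phi>) proj_points proj_points"
    proof (rule bij_betwI')
      show "\<phi> ` P = \<phi> ` Q \<longleftrightarrow> P = Q" for P Q
        using bij by (simp add: bij_is_inj inj_image_eq_iff)
      show "\<phi> ` P \<in> proj_points" if P: "P \<in> proj_points" for P
      proof -
        obtain w where "w \<noteq> 0" "P = V.span {w}"
          using P by (rule proj_pointsE)
        then have "\<phi> w \<noteq> 0" "\<phi> ` P = V.span {\<phi> w}" using nz sp by simp_all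
        then show ?thesis unfolding proj_points_iff by blast
      qed
      show "\<exists>P\<in>proj_points. Q = \<phi> ` P" if Q: "Q \<in> proj_points" for Q
      proof -
        obtain w where w: "w \<noteq> 0" "Q = V.span {w}"
          using Q by (rule proj_pointsE)
        obtain v where v: "w = \<phi> v" using surjD[OF bij_is_surj[OF bij], of w] by blast
        have "v \<noteq> 0" using w v nz by blast
        then have "V.span {v} \<in> proj_points" unfolding proj_points_iff by blast
        moreover have "Q = \<phi> ` V.span {v}" using sp[of v] v w by simp
        ultimately show ?thesis by blast
      qed
    qed
  next
    fix P Q R :: "('i \<Rightarrow> 'a) set"
    assume "P \<in> proj_points" "Q \<in> proj_points" "R \<in> proj_points"
    then show "(R \<subseteq> span UNIV (P \<union> Q)) = (\<phi> ` R \<subseteq> span UNIV (\<phi> ` P \<union> \<phi> ` Q))"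
      by (elim proj_pointsE) (simp add: span_UNIV_eq sp span_pair_subset_iff pair)
  qed
  show "(`) \<phi> ` linset U = linset (\<phi> ` U)"
    using nz zero inj by (auto simp: linset_eq image_image sp) 
qed

subsection \<open>The fundamental theorem of projective geometry\<close>

text \<open>For independent \<open>x\<close> and \<open>y\<close>, expanding
  \<open>g (c *s (x + y))\<close> in two ways forces the factors of \<open>c\<close> at
  \<open>x\<close> and at \<open>y\<close> to agree. Within the line of \<open>x0\<close> the
  comparison passes through \<open>y0\<close>, which is why two independent vectors are assumed.
  Both the fundamental theorem and the classification obtain their automorphism from this
  lemma.\<close>

lemma additive_point_map_semilinear:
  fixes g :: "('i \<Rightarrow> 'a::field) \<Rightarrow> ('j \<Rightarrow> 'a)"
  assumes T: "V.subspace T"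
    and add: "\<And>x y. x \<in> T \<Longrightarrow> y \<in> T \<Longrightarrow> g (x + y) = g x + g y"
    and pt: "\<And>c x. x \<in> T \<Longrightarrow> g (c *s x) \<in> V.span {g x}"
    and nz: "\<And>x. x \<in> T \<Longrightarrow> x \<noteq> 0 \<Longrightarrow> g x \<noteq> 0"
    and indep: "\<And>x y. x \<in> T \<Longrightarrow> y \<in> T \<Longrightarrow> x \<noteq> 0 \<Longrightarrow> y \<notin> V.span {x} \<Longrightarrow> g y \<notin> V.span {g x}"
    and two: "x0 \<in> T" "y0 \<in> T" "x0 \<noteq> 0" "y0 \<notin> V.span {x0}"
  shows "\<exists>s. (\<forall>c. \<forall>x\<in>T. g (c *s x) = s c *s g x) \<and>
    (\<forall>c d. s (c + d) = s c + s d) \<and> (\<forall>c d. s (c * d) = s c * s d) \<and> s 1 = 1"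
proof -
  note Tsc = V.subspace_scale[OF T] and Tad = V.subspace_add[OF T]
  have zero: "g 0 = 0" using add[of 0 0] V.subspace_0[OF T] by simp
  have "\<exists>k. \<forall>c. x \<in> T \<longrightarrow> g (c *s x) = k c *s g x" for x
    using pt[of x] unfolding in_span_singleton by metis
  then obtain k where k: "\<And>x c. x \<in> T \<Longrightarrow> g (c *s x) = k x c *s g x" by metis
  have same: "k x c = k y c" if xy: "x \<in> T" "y \<in> T" "x \<noteq> 0" "y \<notin> V.span {x}" for x y c
  proof -
    have "k x c *s g x + k y c *s g y = g (c *s x + c *s y)"
      using xy by (simp add: add Tsc k)
    also have "c *s x + c *s y = c *s (x + y)" by (rule V.scale_right_distrib[symmetric])
    also have "g (c *s (x + y)) = k (x + y) c *s g (x + y)"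
      by (rule k[OF Tad[OF xy(1,2)]])
    also have "\<dots> = k (x + y) c *s g x + k (x + y) c *s g y"
      using xy by (simp add: add V.scale_right_distrib)
    finally have eq: "k x c *s g x + k y c *s g y = k (x + y) c *s g x + k (x + y) c *s g y" .
    show ?thesis
      using indep2_coeffs[OF nz[OF xy(1,3)] indep[OF xy] eq] by simp
  qed
  define s where "s = k x0"
  have ks: "k x c = s c" if x: "x \<in> T" "x \<noteq> 0" for x c
  proof (cases "x \<in> V.span {x0}")
    case False
    then show ?thesis using same[OF two(1) x(1) two(3)] by (simp add: s_def)
  next
    case True
    then have "V.span {x} = V.span {x0}" using span_singleton_eq_iff x two by blast
    then have "k x c = k y0 c" using same[OF x(1) two(2) x(2)] two(4) by simp
    also have "\<dots> = s c" using same[OF two] by (simp add: s_def)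
    finally show ?thesis .
  qed
  have s: "g (c *s x) = s c *s g x" if "x \<in> T" for x c
    using ks k that by (cases "x = 0") (simp_all add: zero)
  note gx0 = nz[OF two(1,3)]
  show ?thesis
  proof (intro exI[of _ s] conjI allI ballI)
    show "s (c + d) = s c + s d" for c d
    proof -
      have "s (c + d) *s g x0 = g ((c + d) *s x0)" by (simp only: s two(1))
      also have "\<dots> = g (c *s x0 + d *s x0)" by (simp only: V.scale_left_distrib)
      also have "\<dots> = (s c + s d) *s g x0"
        using two by (simp add: add Tsc s V.scale_left_distrib)
      finally show ?thesis using gx0 by simp
    qed
    show "s (c * d) = s c * s d" for c d
    proof -
      have "s (c * d) *s g x0 = g (c *s d *s x0)" using s two by simp
      also have "\<dots> = (s c * s d) *s g x0"
        using two by (simp only: Tsc s) simp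
      finally show ?thesis using gx0 by simp
    qed
    show "s 1 = 1" using s[OF two(1), of 1] gx0
      by (metis V.scale_one V.scale_right_imp_eq)
  qed (use s in auto)
qed

lemma exists_outside_pair:
  fixes u v :: "'i::finite \<Rightarrow> 'a::{finite,field}"
  assumes "card (UNIV :: 'i set) \<ge> 3"
  shows "\<exists>w. w \<notin> V.span {u, v}"
proof (rule ccontr)
  let ?Q = "card (UNIV :: 'a set)"
  assume "\<not> ?thesis"
  then have "UNIV = (\<lambda>(a, b). a *s u + b *s v) ` (UNIV \<times> UNIV)"
    by (auto simp: in_span_pair image_iff)
  then have "card (UNIV :: ('i \<Rightarrow> 'a) set) \<le> card ((UNIV :: 'a set) \<times> (UNIV :: 'a set))"
    by (metis card_image_le finite)
  also have "\<dots> = ?Q ^ 2" by (subst card_cartesian_product) (simp add: power2_eq_square)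
  also have "card (UNIV :: ('i \<Rightarrow> 'a) set) = ?Q ^ card (UNIV :: 'i set)"
    using card_PiE[of "UNIV :: 'i set" "\<lambda>_. UNIV :: 'a set"] by (simp add: PiE_UNIV_domain)
  finally have "card (UNIV :: 'i set) \<le> 2"
    using card_subfield_ge_2[OF subfield_set_UNIV, where 'a='a]
    by (subst (asm) power_increasing_iff) auto
  then show False using assms by simp
qed

text \<open>Normalising the image vector of \<open>v\<close> by \<open>f \<langle>a + v\<rangle> = \<langle>b + h v\<rangle>\<close>, where \<open>f \<langle>a\<rangle> = \<langle>b\<rangle>\<close>,
  makes \<open>h\<close> additive on a complement of \<open>\<langle>a\<rangle>\<close>.\<close>
lemma fundamental_theorem_projective_geometry:
  fixes f :: "('i::finite \<Rightarrow> 'a::{finite,field}) set \<Rightarrow> ('i \<Rightarrow> 'a) set"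
  assumes f: "collineation f" and dim: "card (UNIV :: 'i set) \<ge> 3"
  obtains \<phi> s where "\<And>u v. \<phi> (u + v) = \<phi> u + \<phi> v" "\<And>c v. \<phi> (c *s v) = s c *s \<phi> v" "bij \<phi>"
    "\<And>c d. s (c * d) = s c * s d" "s 1 = 1" "bij s" "\<And>v. v \<noteq> 0 \<Longrightarrow> f (V.span {v}) = V.span {\<phi> v}"
proof -
  \<comment> \<open>\<open>rel u u'\<close> says that \<open>u'\<close> represents the image of the
    point of \<open>u\<close>. Being a relation, it leaves the scalar of the representative open
    until it is normalised.\<close>
  define rel where "rel u u' \<longleftrightarrow> u \<noteq> 0 \<and> u' \<noteq> 0 \<and> f (V.span {u}) = V.span {u'}"
    for u u' :: "'i \<Rightarrow> 'a"
  have rel_nz: "rel u u' \<Longrightarrow> u \<noteq> 0 \<and> u' \<noteq> 0" for u u' by (simp add: rel_def)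
  have pp: "u \<noteq> 0 \<Longrightarrow> V.span {u} \<in> proj_points" for u :: "'i \<Rightarrow> 'a"
    unfolding proj_points_iff by blast
  have rel_ex: "\<exists>u'. rel u u'" if "u \<noteq> 0" for u
  proof -
    have "f (V.span {u}) \<in> proj_points"
      using f pp[OF that] unfolding collineation_def by (meson bij_betwE)
    then show ?thesis using that unfolding proj_points_iff rel_def by blast
  qed
  have rel_iff: "w \<in> V.span {u, v} \<longleftrightarrow> w' \<in> V.span {u', v'}"
    if "rel u u'" "rel v v'" "rel w w'" for u u' v v' w w'
  proof -
    have "V.span {w} \<subseteq> span UNIV (V.span {u} \<union> V.span {v}) \<longleftrightarrow>
        f (V.span {w}) \<subseteq> span UNIV (f (V.span {u}) \<union> f (V.span {v}))"
      using f that pp unfolding collineation_def rel_def by blast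
    then show ?thesis using that by (simp add: rel_def span_UNIV_eq span_pair_subset_iff)
  qed
  have rel_iff1: "w \<in> V.span {u} \<longleftrightarrow> w' \<in> V.span {u'}" if "rel u u'" "rel w w'" for u u' w w'
    using rel_iff[OF that(1) that(1) that(2)] by simp
  have sp_scale: "V.span {c *s u} = V.span {u}" if "c \<noteq> 0" "u \<noteq> 0" for c and u :: "'i \<Rightarrow> 'a"
    using that by (subst span_singleton_eq_iff) (auto simp: in_span_singleton)
  have rel_scale: "rel (c *s u) (d *s u')" if "rel u u'" "c \<noteq> 0" "d \<noteq> 0" for u u' c d
    using that by (simp add: rel_def sp_scale)
  have rel_in: "rel u w" if "rel u u'" "w \<in> V.span {u'}" "w \<noteq> 0" for u u' w
    using that span_singleton_eq_iff[of w u'] by (simp add: rel_def)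
  \<comment> \<open>An arbitrary coordinate supplies the unit vector \<open>a\<close> and, further
    down, the complement \<open>H\<close> of its span.\<close>
  obtain i0 :: 'i where True by simp
  define a where "a = (\<lambda>i. if i = i0 then 1 else 0 :: 'a)"
  have ai0: "a i0 = 1" by (simp add: a_def)
  then have a0: "a \<noteq> 0" by (metis zero_fun_apply zero_neq_one)
  obtain b where ab: "rel a b" using rel_ex[OF a0] by blast
  have b0: "b \<noteq> 0" using rel_nz[OF ab] by simp
  \<comment> \<open>The image of the point of \<open>a + v\<close> lies on the line joining the
    images of \<open>a\<close> and \<open>v\<close> and differs from both of them. So both
    coefficients are nonzero and the coefficient of \<open>b\<close> can be scaled to 1.\<close>
  have exh: "\<exists>w. rel v w \<and> rel (a + v) (b + w)" if v: "v \<notin> V.span {a}" for v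
  proof -
    have v0: "v \<noteq> 0" using v V.span_zero by metis
    have av: "a \<notin> V.span {v}" using v span_singleton_eq_iff[OF a0 v0] V.span_base[of v "{v}"] by blast
    have av0: "a + v \<noteq> 0"
    proof
      assume "a + v = 0"
      then have "v = (-1) *s a" by (simp add: eq_neg_iff_add_eq_0 add.commute)
      then show False using v in_span_singleton by blast
    qed
    obtain v' where v': "rel v v'" using rel_ex[OF v0] by blast
    obtain w where w: "rel (a + v) w" using rel_ex[OF av0] by blast
    have "a + v \<in> V.span {a, v}" by (simp add: V.span_add V.span_base)
    then have "w \<in> V.span {b, v'}" using rel_iff[OF ab v' w] by simp
    then obtain x y where xy: "w = x *s b + y *s v'" by (auto simp: in_span_pair)
    have "a + v \<notin> V.span {v}" using av V.span_add_eq2[of v "{v}" a] V.span_base[of v "{v}"] by simp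
    then have "w \<notin> V.span {v'}" using rel_iff1[OF v' w] by simp
    then have x: "x \<noteq> 0" using xy by (auto simp: in_span_singleton)
    have "a + v \<notin> V.span {a}" using v V.span_add_eq[of a "{a}" v] V.span_base[of a "{a}"] by simp
    then have "w \<notin> V.span {b}" using rel_iff1[OF ab w] by simp
    then have y: "y \<noteq> 0" using xy by (auto simp: in_span_singleton)
    have "rel v ((inverse x * y) *s v')" using rel_scale[OF v', of 1] x y by simp
    moreover have "rel (a + v) (inverse x *s w)" using rel_scale[OF w, of 1] x by simp
    moreover have "inverse x *s w = b + (inverse x * y) *s v'"
      using x by (simp add: xy V.scale_right_distrib)
    ultimately show ?thesis by metis
  qed
  \<comment> \<open>Zero represents no point and gets its value by hand; additivity on
    \<open>H\<close> requires this value to be zero.\<close>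
  define h where "h v = (if v = 0 then 0 else SOME w. rel v w \<and> rel (a + v) (b + w))" for v
  have h0: "h 0 = 0" by (simp add: h_def)
  have h: "rel v (h v)" "rel (a + v) (b + h v)" if "v \<notin> V.span {a}" for v
  proof -
    have "v \<noteq> 0" using that V.span_zero by metis
    then show "rel v (h v)" "rel (a + v) (b + h v)"
      using someI_ex[OF exh[OF that]] by (simp_all add: h_def)
  qed
  have hb: "h v \<notin> V.span {b}" if "v \<notin> V.span {a}" for v
    using rel_iff1[OF ab h(1)] that by blast
  have h_unique: "w = h v" if v: "v \<notin> V.span {a}" and w: "rel v w" "rel (a + v) (b + w)" for v w
  proof -
    have "V.span {w} = V.span {h v}" using h(1)[OF v] w(1) by (simp add: rel_def)
    then obtain k where k: "w = k *s h v" using V.span_base[of w "{w}"] by (auto simp: in_span_singleton)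
    have "V.span {b + w} = V.span {b + h v}" using h(2)[OF v] w(2) by (simp add: rel_def)
    then obtain l where l: "b + w = l *s (b + h v)"
      using V.span_base[of "b + w" "{b + w}"] by (auto simp: in_span_singleton)
    have "1 *s b + k *s h v = l *s b + l *s h v" using k l by (simp add: V.scale_right_distrib)
    then have "1 = l" "k = l" using indep2_coeffs[OF b0 hb[OF v]] by blast+
    then show ?thesis using k by simp
  qed
  \<comment> \<open>The point of \<open>a + (v + w)\<close> is where the lines through
    \<open>a + v\<close>, \<open>w\<close> and through \<open>a + w\<close>, \<open>v\<close> meet.
    The point of \<open>v + w\<close> is where the lines through \<open>v\<close>, \<open>w\<close>
    and through \<open>a + (v + w)\<close>, \<open>a\<close> meet. Both images are thus determined,
    and \<open>h_unique\<close> compares them.\<close>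
  have h_add: "h (v + w) = h v + h w" if v: "v \<notin> V.span {a}" and w: "w \<notin> V.span {a, v}" for v w
  proof -
    have sub: "V.span {a} \<subseteq> V.span {a, v}" by (rule V.span_mono) simp
    then have wa: "w \<notin> V.span {a}" using w by blast
    have vw: "v + w \<notin> V.span {a, v}" using w V.span_add_eq[of v "{a, v}" w] by (simp add: V.span_base)
    then have vwa: "v + w \<notin> V.span {a}" using sub by blast
    have nb: "h w \<notin> V.span {b, h v}" using rel_iff[OF ab h(1)[OF v] h(1)[OF wa]] w by simp
    note ind = indep3_coeffs[OF b0 hb[OF v] nb]
    have "a + (v + w) \<notin> V.span {a}"
      using vwa V.span_add_eq[of a "{a}" "v + w"] V.span_base[of a "{a}"] by simp
    then have "a + (v + w) \<noteq> 0" using V.span_zero by metis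
    then obtain u where u: "rel (a + (v + w)) u" using rel_ex by blast
    have "v + w \<noteq> 0" using vwa V.span_zero by metis
    then obtain z where z: "rel (v + w) z" using rel_ex by blast
    have "a + (v + w) \<in> V.span {a + v, w}" unfolding in_span_pair
      by (intro exI[of _ 1]) (simp add: add.assoc)
    then have "u \<in> V.span {b + h v, h w}" using rel_iff[OF h(2)[OF v] h(1)[OF wa] u] by simp
    then obtain x y where xy: "u = x *s (b + h v) + y *s h w" by (auto simp: in_span_pair)
    have "a + (v + w) \<in> V.span {a + w, v}" unfolding in_span_pair
      by (intro exI[of _ 1]) (simp add: algebra_simps)
    then have "u \<in> V.span {b + h w, h v}" using rel_iff[OF h(2)[OF wa] h(1)[OF v] u] by simp
    then obtain x' y' where xy': "u = x' *s (b + h w) + y' *s h v" by (auto simp: in_span_pair)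
    have "x *s b + x *s h v + y *s h w = x' *s b + y' *s h v + x' *s h w"
      using xy xy' by (simp add: V.scale_right_distrib algebra_simps)
    from ind[OF this] have ueq: "u = x *s (b + (h v + h w))"
      using xy by (simp add: V.scale_right_distrib algebra_simps)
    have x: "x \<noteq> 0" using ueq rel_nz[OF u] by auto
    have sum1: "rel (a + (v + w)) (b + (h v + h w))"
      using rel_scale[OF u, of 1 "inverse x"] x by (simp add: ueq)
    have "v + w \<in> V.span {v, w}" by (simp add: V.span_add V.span_base)
    then have "z \<in> V.span {h v, h w}" using rel_iff[OF h(1)[OF v] h(1)[OF wa] z] by simp
    then obtain c d where cd: "z = c *s h v + d *s h w" by (auto simp: in_span_pair)
    have "v + w \<in> V.span {a + (v + w), a}" unfolding in_span_pair
      by (intro exI[of _ 1] exI[of _ "-1"]) (simp add: algebra_simps)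
    then have "z \<in> V.span {b + (h v + h w), b}" using rel_iff[OF sum1 ab z] by simp
    then obtain c' d' where cd': "z = c' *s (b + (h v + h w)) + d' *s b" by (auto simp: in_span_pair)
    have "0 *s b + c *s h v + d *s h w = (c' + d') *s b + c' *s h v + c' *s h w"
      using cd cd' by (simp add: V.scale_right_distrib V.scale_left_distrib algebra_simps)
    from ind[OF this] have zeq: "z = c *s (h v + h w)"
      using cd by (simp add: V.scale_right_distrib)
    have c: "c \<noteq> 0" using zeq rel_nz[OF z] by auto
    have sum2: "rel (v + w) (h v + h w)"
      using rel_scale[OF z, of 1 "inverse c"] c by (simp add: zeq)
    show ?thesis using h_unique[OF vwa sum2 sum1] by simp
  qed
  define H where "H = {v :: 'i \<Rightarrow> 'a. v i0 = 0}"
  have H: "V.subspace H" by (auto simp: H_def V.subspace_def)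
  have Ha: "v \<notin> V.span {a}" if "v \<in> H" "v \<noteq> 0" for v
  proof
    assume "v \<in> V.span {a}"
    then obtain k where k: "v = k *s a" by (auto simp: in_span_singleton)
    then have "k = 0" using that ai0 by (simp add: H_def)
    then show False using k that by simp
  qed
  have H_ex: "\<exists>z\<in>H. z \<notin> V.span {a, v}" for v
  proof -
    obtain w where w: "w \<notin> V.span {a, v}" using exists_outside_pair[OF dim] by blast
    have "w - w i0 *s a \<notin> V.span {a, v}"
      using w V.span_diff V.span_scale V.span_base V.span_add
      by (metis diff_add_cancel insertI1)
    moreover have "w - w i0 *s a \<in> H" by (simp add: H_def ai0)
    ultimately show ?thesis by blast
  qed
  have h_add_H: "h (v + w) = h v + h w" if v: "v \<in> H" and w: "w \<in> H" for v w
  proof (cases "v = 0 \<or> w = 0 \<or> w \<notin> V.span {a, v}")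
    case True
    then show ?thesis using h_add[of v w] Ha[OF v] by (cases "v = 0") (auto simp: h0)
  next
    case False
    then have nz: "v \<noteq> 0" "w \<noteq> 0" and wv: "w \<in> V.span {a, v}" by auto
    \<comment> \<open>For \<open>w\<close> in the span of \<open>a\<close> and \<open>v\<close>, a
      vector \<open>z\<close> outside that span moves each sum into the independent case. This uses
      that the space has dimension at least 3.\<close>
    obtain z where z: "z \<in> H" "z \<notin> V.span {a, v}" using H_ex by blast
    have gen: "h (x + z) = h x + h z" if x: "x \<in> H" "x \<in> V.span {a, v}" for x
    proof (cases "x = 0")
      case False
      have "V.span {a, x} \<subseteq> V.span {a, v}"
        using x by (intro V.span_minimal) (simp_all add: V.span_base)
      then show ?thesis using h_add[OF Ha[OF x(1) False], of z] z by blast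
    qed (simp add: h0)
    have "h v + h w + h z = h v + h (w + z)" using gen[OF w wv] by simp
    also have "\<dots> = h (v + (w + z))"
    proof -
      have "w + z \<notin> V.span {a, v}" using z V.span_add_eq[OF wv] by simp
      then show ?thesis using h_add[OF Ha[OF v nz(1)]] by simp
    qed
    also have "\<dots> = h ((v + w) + z)" by (simp add: add.assoc)
    also have "\<dots> = h (v + w) + h z"
      using v w wv by (intro gen V.span_add V.subspace_add[OF H]) (simp_all add: V.span_base)
    finally show ?thesis by simp
  qed
  obtain x0 where x0: "x0 \<in> H" "x0 \<notin> V.span {a, 0}" using H_ex by blast
  obtain y0 where y0: "y0 \<in> H" "y0 \<notin> V.span {a, x0}" using H_ex by blast
  have y0x0: "y0 \<notin> V.span {x0}"
    using y0(2) V.span_mono[of "{x0}" "{a, x0}"] by blast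
  have "x0 \<noteq> 0" using x0(2) V.span_zero by metis
  have pt: "h (c *s x) \<in> V.span {h x}" if x: "x \<in> H" for c x
  proof (cases "c = 0 \<or> x = 0")
    case True
    then show ?thesis by (auto simp: h0 V.span_zero)
  next
    case False
    then have "c *s x \<in> H" "c *s x \<noteq> 0" using V.subspace_scale[OF H x] by auto
    moreover have "c *s x \<in> V.span {x}" using in_span_singleton by blast
    ultimately show ?thesis using rel_iff1[OF h(1) h(1)] Ha x False by blast
  qed
  have hnz: "h x \<noteq> 0" if "x \<in> H" "x \<noteq> 0" for x
    using rel_nz[OF h(1)[OF Ha[OF that]]] by simp
  have hind: "h y \<notin> V.span {h x}" if "x \<in> H" "y \<in> H" "x \<noteq> 0" "y \<notin> V.span {x}" for x y
  proof -
    have "y \<noteq> 0" using that(4) V.span_zero by metis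
    then show ?thesis using rel_iff1[OF h(1) h(1)] Ha that by blast
  qed
  have "\<exists>s. (\<forall>c. \<forall>x\<in>H. h (c *s x) = s c *s h x) \<and>
    (\<forall>c d. s (c + d) = s c + s d) \<and> (\<forall>c d. s (c * d) = s c * s d) \<and> s 1 = 1"
    by (rule additive_point_map_semilinear[OF H h_add_H pt hnz hind x0(1) y0(1) \<open>x0 \<noteq> 0\<close> y0x0]) assumption+
  then obtain s where s: "\<And>c x. x \<in> H \<Longrightarrow> h (c *s x) = s c *s h x"
    "\<And>c d. s (c + d) = s c + s d" "\<And>c d. s (c * d) = s c * s d" "s 1 = 1"
    by blast
  have s0: "s 0 = 0" using s(2)[of 0 0] by (metis add_cancel_right_left add_0)
  have s_nz: "s c \<noteq> 0" if "c \<noteq> 0" for c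
    using s(3)[of c "inverse c"] s(4) that by auto
  \<comment> \<open>The coefficient of \<open>a\<close> is twisted by the same \<open>s\<close> that
    belongs to \<open>h\<close> on \<open>H\<close>; only then is the extension semilinear on the
    whole space.\<close>
  define \<phi> where "\<phi> v = s (v i0) *s b + h (v - v i0 *s a)" for v
  have pr: "v - v i0 *s a \<in> H" for v by (simp add: H_def ai0)
  have add: "\<phi> (u + v) = \<phi> u + \<phi> v" for u v
  proof -
    have eq: "(u + v) - (u + v) i0 *s a = (u - u i0 *s a) + (v - v i0 *s a)"
      by (simp add: V.scale_left_distrib algebra_simps)
    have "h ((u + v) - (u + v) i0 *s a) = h (u - u i0 *s a) + h (v - v i0 *s a)"
      unfolding eq by (rule h_add_H[OF pr pr])
    then show ?thesis by (simp add: \<phi>_def s(2) V.scale_left_distrib algebra_simps)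
  qed
  have scale: "\<phi> (c *s v) = s c *s \<phi> v" for c v
  proof -
    have "c *s v - (c *s v) i0 *s a = c *s (v - v i0 *s a)"
      by (simp add: V.scale_right_diff_distrib)
    then have "h (c *s v - (c *s v) i0 *s a) = s c *s h (v - v i0 *s a)"
      using s(1)[OF pr] by simp
    then show ?thesis by (simp add: \<phi>_def s(3) V.scale_right_distrib)
  qed
  have rel\<phi>: "rel v (\<phi> v)" if v: "v \<noteq> 0" for v
  proof (cases "v i0 = 0")
    case True
    then have "v \<in> H" by (simp add: H_def)
    then show ?thesis using h(1)[OF Ha] v True by (simp add: \<phi>_def s0)
  next
    case False
    \<comment> \<open>Scaling brings the vector to the form \<open>a + w\<close> with
      \<open>w\<close> in \<open>H\<close>, the shape for which \<open>h\<close> was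
      normalised.\<close>
    define u where "u = inverse (v i0) *s v"
    have v_u: "v = v i0 *s u" using False by (simp add: u_def)
    have ui0: "u i0 = 1" using False by (simp add: u_def)
    define w where "w = u - a"
    have wH: "w \<in> H" by (simp add: w_def H_def ui0 ai0)
    have uw: "u = a + w" by (simp add: w_def)
    have \<phi>u: "\<phi> u = b + h w" by (simp add: \<phi>_def ui0 s(4) flip: w_def)
    have "rel u (\<phi> u)"
      using h(2)[OF Ha[OF wH]] ab by (cases "w = 0") (simp_all add: \<phi>u h0, simp_all add: uw)
    then have "rel (v i0 *s u) (s (v i0) *s \<phi> u)" using rel_scale s_nz False by blast
    then show ?thesis by (metis scale v_u)
  qed
  have "inj \<phi>"
  proof (rule injI)
    fix u v assume uv: "\<phi> u = \<phi> v"
    have "\<phi> (u - v) + \<phi> v = \<phi> u" by (metis add diff_add_cancel)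
    then have "\<phi> (u - v) = 0" using uv by simp
    then show "u = v" using rel\<phi>[of "u - v"] rel_nz by (metis eq_iff_diff_eq_0)
  qed
  then have "bij \<phi>" by (simp add: bij_def finite_UNIV_inj_surj)
  moreover have "f (V.span {v}) = V.span {\<phi> v}" if "v \<noteq> 0" for v
    using rel\<phi>[OF that] by (simp add: rel_def)
  moreover have "bij s"
  proof -
    have "inj s"
    proof (rule injI)
      fix c d assume "s c = s d"
      moreover have "s (c - d) + s d = s c" by (metis s(2) diff_add_cancel)
      ultimately have "s (c - d) = 0" by simp
      then show "c = d" using s_nz[of "c - d"] by auto
    qed
    then show ?thesis by (simp add: bij_def finite_UNIV_inj_surj)
  qed
  ultimately show thesis using that[of \<phi> s] add scale s(3,4) by blast
qed

subsection \<open>Graphs of semilinear bijections\<close>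

lemma span_singleton_disjoint:
  assumes "x \<noteq> 0" "y \<noteq> 0" "V.span {x} \<noteq> V.span {y}"
  shows "V.span {x} \<inter> V.span {y} = {0}"
proof -
  have "z = 0" if z: "z \<in> V.span {x}" "z \<in> V.span {y}" for z
  proof (rule ccontr)
    assume "z \<noteq> 0"
    then have "V.span {z} = V.span {x}" "V.span {z} = V.span {y}"
      using z assms by (simp_all add: span_singleton_eq_iff)
    then show False using assms(3) by simp
  qed
  then show ?thesis using V.span_zero by blast
qed

text \<open>The points partition the nonzero vectors of \<open>W\<close> into classes of size
  \<open>m - 1\<close>. Besides subspaces, \<open>W\<close> will be the part of a graph inside a
  subspace, with \<open>m = q\<close>.\<close>

lemma card_points_subset:
  fixes W :: "('i::finite \<Rightarrow> 'a::{finite,field}) set"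
  assumes "\<And>x. x \<in> W - {0} \<Longrightarrow> card (V.span {x} \<inter> W) = m" "0 \<in> W"
  shows "card ((\<lambda>x. V.span {x}) ` (W - {0})) * (m - 1) = card W - 1"
proof -
  let ?P = "(\<lambda>x. V.span {x}) ` (W - {0})"
  let ?f = "\<lambda>P. P \<inter> (W - {0})"
  have in_f: "x \<in> ?f (V.span {x})" if "x \<in> W - {0}" for x
    using that by (simp add: V.span_base)
  have disj: "?f P \<inter> ?f P' = {}" if "P \<in> ?P" "P' \<in> ?P" "P \<noteq> P'" for P P'
    using that span_singleton_disjoint by blast
  have inj: "inj_on ?f ?P"
    using disj in_f by (intro inj_onI) (metis (no_types, lifting) IntI emptyE imageE)
  have "(m - 1) * card (?f ` ?P) = card (\<Union> (?f ` ?P))"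
  proof (rule card_partition)
    fix c assume "c \<in> ?f ` ?P"
    then obtain x where x: "x \<in> W - {0}" "c = V.span {x} \<inter> W - {0}" by auto
    moreover have "0 \<in> V.span {x} \<inter> W" using assms(2) V.span_zero by blast
    ultimately show "card c = m - 1" using assms(1) by (simp add: card_Diff_singleton)
  next
    fix c1 c2 assume "c1 \<in> ?f ` ?P" "c2 \<in> ?f ` ?P" "c1 \<noteq> c2"
    then show "c1 \<inter> c2 = {}" using disj by blast
  qed simp_all
  moreover have "\<Union> (?f ` ?P) = W - {0}" using in_f by blast
  ultimately show ?thesis
    using assms(2) by (simp add: card_image[OF inj] card_Diff_singleton mult.commute)
qed

lemma card_points_subspace:
  fixes T :: "('i::finite \<Rightarrow> 'a::{finite,field}) set"
  assumes "V.subspace T"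
  shows "card ((\<lambda>x. V.span {x}) ` (T - {0})) * (card (UNIV :: 'a set) - 1) = card T - 1"
proof (rule card_points_subset)
  fix x assume x: "x \<in> T - {0}"
  then have "V.span {x} \<inter> T = V.span {x}" using assms V.span_minimal[of "{x}" T] by blast
  then show "card (V.span {x} \<inter> T) = card (UNIV :: 'a set)" using x by (simp add: card_span_singleton)
qed (simp add: V.subspace_0[OF assms])

text \<open>The pieces \<open>s \<inter> W - {0}\<close> are disjoint and together already as large
  as \<open>W - {0}\<close>. Applied both to \<open>U\<close> and to transversal spaces, with
  \<open>k = q ^ t - 1\<close>.\<close>

lemma covered_by_counting:
  fixes W :: "('i::finite \<Rightarrow> 'a::{finite,field}) set"
  assumes big: "\<And>s. s \<in> S \<Longrightarrow> k \<le> card (s \<inter> W - {0})"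
    and disj: "\<And>s s'. s \<in> S \<Longrightarrow> s' \<in> S \<Longrightarrow> s \<noteq> s' \<Longrightarrow> s \<inter> s' \<subseteq> {0}"
    and cardW: "card W \<le> card S * k + 1" and "0 \<in> W"
  shows "W - {0} \<subseteq> \<Union>S"
proof -
  let ?X = "\<Union>s\<in>S. s \<inter> W - {0}"
  have "card S * k \<le> (\<Sum>s\<in>S. card (s \<inter> W - {0}))"
    using sum_mono[of S "\<lambda>_. k" "\<lambda>s. card (s \<inter> W - {0})"] big by simp
  also have "\<dots> = card ?X" using disj by (intro card_UN_disjoint[symmetric]) auto
  finally have "card (W - {0}) \<le> card ?X" using cardW \<open>0 \<in> W\<close> by (simp add: card_Diff_singleton)
  moreover have "?X \<subseteq> W - {0}" by blast
  ultimately have "?X = W - {0}" by (intro card_seteq) auto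
  then show ?thesis by blast
qed

lemma subspace_line_eq:
  fixes l :: "('i::finite \<Rightarrow> 'a::{finite,field}) set"
  assumes "V.subspace l" "card l = card (UNIV :: 'a set) ^ 2" "u \<in> l" "v \<in> l" "u \<noteq> 0" "v \<notin> V.span {u}"
  shows "l = V.span {u, v}"
proof -
  have "V.span {u, v} \<subseteq> l" using assms by (intro V.span_minimal) auto
  then show ?thesis using card_span_pair[OF assms(5,6)] assms(2) by (intro card_seteq[symmetric]) auto
qed

lemma direct_sum_unique:
  fixes T1 T2 :: "('i \<Rightarrow> 'a::field) set"
  assumes T: "V.subspace T1" "V.subspace T2" "T1 \<inter> T2 = {0}"
    and xy: "x \<in> T1" "x' \<in> T1" "y \<in> T2" "y' \<in> T2" "x + y = x' + y'"
  shows "x = x'" "y = y'"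
proof -
  have "x - x' = y' - y" using xy(5) by (metis add.commute add_diff_eq diff_eq_eq)
  moreover have "x - x' \<in> T1" "y' - y \<in> T2"
    using xy V.subspace_diff[OF T(1)] V.subspace_diff[OF T(2)] by auto
  ultimately have "x - x' \<in> T1 \<inter> T2" by simp
  then show "x = x'" unfolding T(3) by simp
  then show "y = y'" using xy(5) by simp
qed

context field_ext begin

lemma subfield_subfieldq: "subfield_set (subfieldq q :: 'a set)"
proof -
  have add: "(x + y :: 'a) ^ q = x ^ q + y ^ q" for x y using frob_add[of x y 1] by simp
  have zero: "(0::'a) ^ q = 0" using frob_zero[of 1] by simp
  have "(- x :: 'a) ^ q = - (x ^ q)" for x
    using add[of x "-x"] zero by (simp add: eq_neg_iff_add_eq_0 add.commute)
  then show ?thesis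
    unfolding subfield_set_def subfieldq_def
    by (simp add: add zero power_mult_distrib power_inverse)
qed

lemma q_less_q_pow_t: "q < q ^ t"
  using power_strict_increasing[of 1 t q] q_ge_2 t_ge_3 by simp

lemma frob_not_all_fixed: "coprime i t \<Longrightarrow> \<exists>c::'a. c ^ (q ^ i) \<noteq> c"
proof (rule ccontr)
  assume "coprime i t" "\<nexists>c::'a. c ^ (q ^ i) \<noteq> c"
  then have "(UNIV :: 'a set) = subfieldq q" using frob_fix_iff by blast
  then show False using card_subfieldq card_field q_less_q_pow_t by simp
qed

end

locale ambient = field_ext q t TY
  for q t and TY :: "'a::{finite,field} itself" +
  fixes n :: nat and IY :: "'i::finite itself"
  assumes card_index: "card (UNIV :: 'i set) = 2 * n" and n_ge_2: "n \<ge> 2"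
begin

lemma card_space: "card (UNIV :: ('i \<Rightarrow> 'a) set) = q ^ (t * n) * q ^ (t * n)"
  using card_PiE[of "UNIV :: 'i set" "\<lambda>_. UNIV :: 'a set"]
  by (simp add: PiE_UNIV_domain card_field card_index mult_2 power_add flip: power_mult)

lemma q_pow_tn_gt: "q ^ t < q ^ (t * n)"
  using q_ge_2 t_ge_3 n_ge_2 by (intro power_strict_increasing) auto

text \<open>Rests on \<open>n \<ge> 2\<close>, by which \<open>T\<close> is larger than a point.
  With \<open>x = 0\<close> it also provides a nonzero vector of \<open>T\<close>.\<close>

lemma exists_outside_span:
  fixes T :: "('i \<Rightarrow> 'a) set"
  assumes "card T = q ^ (t * n)"
  shows "\<exists>y\<in>T. y \<notin> V.span {x}"
proof (rule ccontr)
  assume "\<not> ?thesis"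
  then have "card T \<le> card (V.span {x})" by (intro card_mono) auto
  moreover have "card (V.span {x}) \<le> q ^ t"
    using card_span_singleton[of x] by (cases "x = 0") (use card_field q_ge_2 in auto)
  ultimately show False using assms q_pow_tn_gt by simp
qed

lemma direct_sum_exists:
  fixes T1 T2 :: "('i \<Rightarrow> 'a) set"
  assumes "V.subspace T1" "V.subspace T2" "T1 \<inter> T2 = {0}"
    and "card T1 = q ^ (t * n)" "card T2 = q ^ (t * n)"
  shows "\<exists>x\<in>T1. \<exists>y\<in>T2. v = x + y"
proof -
  have "inj_on (\<lambda>(x, y). x + y) (T1 \<times> T2)"
    using direct_sum_unique[OF assms(1-3)] by (auto intro!: inj_onI)
  then have "card ((\<lambda>(x, y). x + y) ` (T1 \<times> T2)) = card (UNIV :: ('i \<Rightarrow> 'a) set)"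
    by (simp add: card_image card_cartesian_product assms(4,5) card_space)
  then have "(\<lambda>(x, y). x + y) ` (T1 \<times> T2) = UNIV" by (intro card_eq_UNIV_imp_eq_UNIV) auto
  then have "v \<in> (\<lambda>(x, y). x + y) ` (T1 \<times> T2)" by blast
  then show ?thesis by auto
qed

end

text \<open>The exponent \<open>i\<close> is a natural number, not a residue modulo
  \<open>t\<close>, so \<open>i\<close> and \<open>i + t\<close> describe the same automorphism;
  statements about uniqueness add \<open>i < t\<close>.\<close>

locale semilinear_graph = ambient q t TY n IY
  for q t and TY :: "'a::{finite,field} itself" and n and IY :: "'i::finite itself" +
  fixes i :: nat and T1 T2 :: "('i \<Rightarrow> 'a) set" and g :: "('i \<Rightarrow> 'a) \<Rightarrow> ('i \<Rightarrow> 'a)"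
  assumes coprime_i: "coprime i t"
    and T1: "V.subspace T1" and T2: "V.subspace T2"
    and card_T1: "card T1 = q ^ (t * n)" and card_T2: "card T2 = q ^ (t * n)"
    and T_disjoint: "T1 \<inter> T2 = {0}" and g_bij: "bij_betw g T1 T2"
    and g_add: "\<And>x y. x \<in> T1 \<Longrightarrow> y \<in> T1 \<Longrightarrow> g (x + y) = g x + g y"
    and g_scale: "\<And>c x. x \<in> T1 \<Longrightarrow> g (c *s x) = c ^ (q ^ i) *s g x"
begin

definition graph where "graph = (\<lambda>x. x + g x) ` T1"

definition lines where "lines = (\<lambda>x. V.span {x, g x}) ` (T1 - {0})"

lemma g_in: "x \<in> T1 \<Longrightarrow> g x \<in> T2"
  using g_bij by (auto simp: bij_betw_def)

lemma g_inj: "x \<in> T1 \<Longrightarrow> y \<in> T1 \<Longrightarrow> g x = g y \<Longrightarrow> x = y"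
  using g_bij by (meson bij_betw_def inj_onD)

lemma g_surj: "y \<in> T2 \<Longrightarrow> \<exists>x\<in>T1. y = g x"
  using g_bij by (auto simp: bij_betw_def)

lemma g_zero: "g 0 = 0"
  using g_add[of 0 0] V.subspace_0[OF T1] by simp

lemma g_eq_0: "x \<in> T1 \<Longrightarrow> g x = 0 \<longleftrightarrow> x = 0"
  using g_inj[of x 0] V.subspace_0[OF T1] g_zero by auto

lemmas sum_unique = direct_sum_unique[OF T1 T2 T_disjoint]
  and sum_exists = direct_sum_exists[OF T1 T2 T_disjoint card_T1 card_T2]

lemma g_span: 
  assumes "x \<in> T1" "y \<in> T1"
  shows "g y \<in> V.span {g x} \<longleftrightarrow> y \<in> V.span {x}"
proof
  assume "g y \<in> V.span {g x}"
  then obtain c where "g y = c *s g x" by (auto simp: in_span_singleton)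
  moreover obtain d :: 'a where "d ^ (q ^ i) = c" using frob_surj by blast
  ultimately have "g y = g (d *s x)" using assms by (simp add: g_scale)
  then have "y = d *s x" using assms g_inj V.subspace_scale[OF T1] by blast
  then show "y \<in> V.span {x}" by (auto simp: in_span_singleton)
next
  assume "y \<in> V.span {x}"
  then show "g y \<in> V.span {g x}" using assms by (auto simp: in_span_singleton g_scale)
qed

lemma span_T1: "x \<in> T1 \<Longrightarrow> V.span {x} \<subseteq> T1"
  by (simp add: V.span_minimal[OF _ T1])

text \<open>Each line is the sum of its points in \<open>T1\<close> and \<open>T2\<close>, so
  membership can be tested on components; most later arguments about lines go through this.\<close>

lemma in_line_iff:
  assumes "x \<in> T1" "X \<in> T1" "Y \<in> T2"
  shows "X + Y \<in> V.span {x, g x} \<longleftrightarrow> X \<in> V.span {x} \<and> Y \<in> V.span {g x}"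
proof
  assume "X + Y \<in> V.span {x, g x}"
  then obtain a b where ab: "X + Y = a *s x + b *s g x" by (auto simp: in_span_pair)
  have "a *s x \<in> T1" "b *s g x \<in> T2"
    using assms g_in V.subspace_scale[OF T1] V.subspace_scale[OF T2] by auto
  then have "X = a *s x" "Y = b *s g x" using sum_unique assms ab by blast+
  then show "X \<in> V.span {x} \<and> Y \<in> V.span {g x}" by (auto simp: in_span_singleton)
next
  assume "X \<in> V.span {x} \<and> Y \<in> V.span {g x}"
  then show "X + Y \<in> V.span {x, g x}" by (auto simp: in_span_singleton in_span_pair)
qed

lemma line_eq:
  assumes x: "x \<in> T1" "x \<noteq> 0" and y: "y \<in> V.span {x}" "y \<noteq> 0"
  shows "V.span {y, g y} = V.span {x, g x}"
proof -
  have yT: "y \<in> T1" using span_T1 x y by blast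
  have "g y \<in> V.span {g x}" using g_span[OF x(1) yT] y by simp
  then have "V.span {g y} = V.span {g x}"
    using x y yT by (subst span_singleton_eq_iff) (simp_all add: g_eq_0)
  moreover have "V.span {y} = V.span {x}"
    using x y by (subst span_singleton_eq_iff) simp_all
  ultimately show ?thesis
    using V.span_Un[of "{y}" "{g y}"] V.span_Un[of "{x}" "{g x}"] by (simp add: insert_commute)
qed

lemma lines_disjoint:
  assumes x: "x \<in> T1 - {0}" and y: "y \<in> T1 - {0}" and z: "z \<in> V.span {x, g x}" "z \<in> V.span {y, g y}" "z \<noteq> 0"
  shows "V.span {y} = V.span {x}"
proof -
  obtain X Y where XY: "X \<in> T1" "Y \<in> T2" "z = X + Y" using sum_exists by blast
  have in_x: "X \<in> V.span {x}" "Y \<in> V.span {g x}" using in_line_iff[of x X Y] x z XY by auto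
  have in_y: "X \<in> V.span {y}" "Y \<in> V.span {g y}" using in_line_iff[of y X Y] y z XY by auto
  show ?thesis
  proof (cases "X = 0")
    case False
    then have "V.span {X} = V.span {x}" "V.span {X} = V.span {y}"
      using in_x in_y x y by (simp_all add: span_singleton_eq_iff)
    then show ?thesis by simp
  next
    case True
    then have Y: "Y \<noteq> 0" using z XY by simp
    have "g x \<noteq> 0" "g y \<noteq> 0" using x y g_eq_0 by auto
    then have "V.span {Y} = V.span {g x}" "V.span {Y} = V.span {g y}"
      using in_x in_y Y by (simp_all add: span_singleton_eq_iff)
    then have "g y \<in> V.span {g x}" using V.span_base[of "g y" "{g y}"] by simp
    then have "y \<in> V.span {x}" using g_span x y by blast
    then show ?thesis using x y by (simp add: span_singleton_eq_iff)
  qed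
qed

lemma lines_pairwise_disjoint:
  assumes "s \<in> lines" "s' \<in> lines" "s \<noteq> s'"
  shows "s \<inter> s' = {0}"
proof -
  obtain x y where x: "x \<in> T1 - {0}" "s = V.span {x, g x}" and y: "y \<in> T1 - {0}" "s' = V.span {y, g y}"
    using assms by (auto simp: lines_def)
  have "z = 0" if "z \<in> s" "z \<in> s'" for z
  proof (rule ccontr)
    assume "z \<noteq> 0"
    then have "V.span {y} = V.span {x}" using lines_disjoint x y that by blast
    then have "y \<in> V.span {x}" using V.span_base[of y "{y}"] by simp
    then show False using line_eq[of x y] x y assms by simp
  qed
  then show ?thesis using x y V.span_zero by blast
qed

lemma card_lines: "card lines * (q ^ t - 1) = q ^ (t * n) - 1"
proof -
  have "card lines = card ((\<lambda>x. V.span {x}) ` (T1 - {0}))"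
  proof (rule bij_betw_same_card[symmetric])
    \<comment> \<open>The line is computed from the point \<open>P\<close> as a set, so that no
      representative has to be chosen.\<close>
    show "bij_betw (\<lambda>P. V.span (P \<union> g ` P)) ((\<lambda>x. V.span {x}) ` (T1 - {0})) lines"
    proof (rule bij_betw_imageI)
      have sp: "V.span (V.span {x} \<union> g ` V.span {x}) = V.span {x, g x}" if x: "x \<in> T1" for x
      proof (rule antisym)
        have "g ` V.span {x} \<subseteq> V.span {g x}" using g_span x span_T1[OF x] by blast
        then show "V.span (V.span {x} \<union> g ` V.span {x}) \<subseteq> V.span {x, g x}"
          using V.span_mono[of "{g x}" "{x, g x}"] V.span_mono[of "{x}" "{x, g x}"]
          by (intro V.span_minimal) auto
        show "V.span {x, g x} \<subseteq> V.span (V.span {x} \<union> g ` V.span {x})"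
          by (intro V.span_mono) (auto intro: V.span_base)
      qed
      show "inj_on (\<lambda>P. V.span (P \<union> g ` P)) ((\<lambda>x. V.span {x}) ` (T1 - {0}))"
      proof (rule inj_onI)
        fix P P' assume "P \<in> (\<lambda>x. V.span {x}) ` (T1 - {0})" "P' \<in> (\<lambda>x. V.span {x}) ` (T1 - {0})"
          and eq: "V.span (P \<union> g ` P) = V.span (P' \<union> g ` P')"
        then obtain x y where xy: "x \<in> T1 - {0}" "y \<in> T1 - {0}" "P = V.span {x}" "P' = V.span {y}" by blast
        then have "V.span {x, g x} = V.span {y, g y}" using eq sp by simp
        then have "x \<in> V.span {y, g y}" using V.span_base[of x "{x, g x}"] by simp
        then show "P = P'" using lines_disjoint[OF xy(2,1)] xy V.span_base[of x "{x, g x}"] by simp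
      qed
      show "(\<lambda>P. V.span (P \<union> g ` P)) ` (\<lambda>x. V.span {x}) ` (T1 - {0}) = lines"
        unfolding lines_def image_image using sp by (intro image_cong) auto
    qed
  qed
  then show ?thesis using card_points_subspace[OF T1] by (simp add: card_field card_T1)
qed

lemma g_not_in_span: "x \<in> T1 \<Longrightarrow> x \<noteq> 0 \<Longrightarrow> g x \<notin> V.span {x}"
  using T_disjoint g_in g_eq_0 span_T1 by blast

lemma line_card: "s \<in> lines \<Longrightarrow> V.subspace s \<and> card s = (q ^ t) ^ 2"
  using g_not_in_span card_span_pair[of _ "g _"] by (auto simp: lines_def card_field[symmetric])

lemma graph_subsp: "subsp (subfieldq q) graph"
  unfolding subsp_iff
proof (intro conjI ballI)
  show "0 \<in> graph" unfolding graph_def using V.subspace_0[OF T1] g_zero by force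
next
  fix u v assume "u \<in> graph" "v \<in> graph"
  then obtain x y where xy: "x \<in> T1" "y \<in> T1" "u = x + g x" "v = y + g y" by (auto simp: graph_def)
  then have "u + v = (x + y) + g (x + y)" by (simp add: g_add algebra_simps)
  then show "u + v \<in> graph"
    using imageI[OF V.subspace_add[OF T1 xy(1,2)], of "\<lambda>x. x + g x"] by (simp add: graph_def)
next
  fix c :: 'a and u assume "c \<in> subfieldq q" "u \<in> graph"
  then have c: "c ^ (q ^ i) = c" using frob_fix_iff[OF coprime_i] by simp
  from \<open>u \<in> graph\<close> obtain x where x: "x \<in> T1" "u = x + g x" by (auto simp: graph_def)
  then have "c *s u = c *s x + g (c *s x)" by (simp add: g_scale c V.scale_right_distrib)
  then show "c *s u \<in> graph"
    using imageI[OF V.subspace_scale[OF T1 x(1)], of "\<lambda>x. x + g x" c] by (simp add: graph_def)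
qed

lemma card_graph: "card graph = q ^ (t * n)"
proof -
  have "inj_on (\<lambda>x. x + g x) T1" using sum_unique g_in by (meson inj_onI)
  then show ?thesis by (simp add: graph_def card_image card_T1)
qed

lemma sum_in_graph:
  assumes "x \<in> T1" "y \<in> T2"
  shows "x + y \<in> graph \<longleftrightarrow> y = g x"
proof
  assume "x + y \<in> graph"
  then obtain w where w: "w \<in> T1" "x + y = w + g w" by (auto simp: graph_def)
  show "y = g x" using sum_unique[OF assms(1) w(1) assms(2) g_in[OF w(1)] w(2)] by simp
qed (use assms in \<open>simp add: graph_def\<close>)

text \<open>This is scatteredness: \<open>c *s u\<close> stays in the graph exactly when
  \<open>c\<close> is fixed by the \<open>i\<close>-th Frobenius power, and by coprimality there are
  \<open>q\<close> such scalars.\<close>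

lemma card_span_graph:
  assumes "u \<in> graph" "u \<noteq> 0"
  shows "card (V.span {u} \<inter> graph) = q"
proof -
  obtain x where x: "x \<in> T1" "u = x + g x" using assms by (auto simp: graph_def)
  have x0: "x \<noteq> 0" using x assms g_zero by auto
  have "c *s u \<in> graph \<longleftrightarrow> c \<in> subfieldq q" for c
  proof -
    have "c *s u \<in> graph \<longleftrightarrow> c *s g x = g (c *s x)"
      using sum_in_graph[of "c *s x" "c *s g x"] x V.subspace_scale[OF T1] V.subspace_scale[OF T2] g_in
      by (simp add: V.scale_right_distrib)
    also have "\<dots> \<longleftrightarrow> c ^ (q ^ i) = c" using x x0 g_eq_0 by (auto simp: g_scale)
    finally show ?thesis using frob_fix_iff[OF coprime_i] by simp
  qed
  then have "V.span {u} \<inter> graph = (\<lambda>c. c *s u) ` subfieldq q"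
    unfolding V.span_singleton by blast
  moreover have "inj (\<lambda>c. c *s u)" using assms(2) by (auto intro!: injI)
  ultimately show ?thesis by (simp add: card_image inj_on_subset card_subfieldq)
qed

lemma card_line_graph: "s \<in> lines \<Longrightarrow> card (s \<inter> graph) = q ^ t"
proof -
  assume "s \<in> lines"
  then obtain x where x: "x \<in> T1" "x \<noteq> 0" "s = V.span {x, g x}" by (auto simp: lines_def)
  have "s \<inter> graph = (\<lambda>y. y + g y) ` V.span {x}"
  proof
    show "s \<inter> graph \<subseteq> (\<lambda>y. y + g y) ` V.span {x}"
      using x in_line_iff g_in by (auto simp: graph_def)
    show "(\<lambda>y. y + g y) ` V.span {x} \<subseteq> s \<inter> graph"
      using x in_line_iff[OF x(1)] g_in g_span[OF x(1)] span_T1[OF x(1)] by (auto simp: graph_def)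
  qed
  moreover have "inj_on (\<lambda>x. x + g x) (V.span {x})"
    using sum_unique g_in span_T1[OF x(1)] by (meson inj_onI subsetD)
  ultimately show ?thesis using x by (simp add: card_image card_span_singleton card_field)
qed

end

lemma subsp_Int: "subsp K X \<Longrightarrow> subsp K Y \<Longrightarrow> subsp K (X \<inter> Y)"
  by (auto simp: subsp_iff)

lemma subsp_of_subspace: "V.subspace X \<Longrightarrow> subsp K X"
  by (auto simp: subsp_iff V.subspace_def)

section \<open>Recovering lines and transversal spaces\<close>

context ambient begin

lemma dimK_UNIV_eq_iff:
  fixes X :: "('i \<Rightarrow> 'a) set"
  assumes "V.subspace X"
  shows "dimK UNIV X = d \<longleftrightarrow> card X = (q ^ t) ^ d"
  using dimK_eq_iff[OF subfield_set_UNIV subsp_of_subspace[OF assms]] by (simp add: card_field)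

lemma dimK_subfieldq_eq_iff:
  fixes X :: "('i \<Rightarrow> 'a) set"
  assumes "subsp (subfieldq q) X"
  shows "dimK (subfieldq q) X = d \<longleftrightarrow> card X = q ^ d"
  using dimK_eq_iff[OF subfield_subfieldq assms] by (simp add: card_subfieldq)

text \<open>Depends on the point set \<open>L\<close> alone. For scattered \<open>U\<close> every
  point of \<open>L\<close> carries \<open>q - 1\<close> nonzero vectors of \<open>U\<close>, so the
  number compared with \<open>q ^ 2\<close> is the size of \<open>U \<inter> l\<close>.
  Equivalently, \<open>l\<close> contains more than \<open>q + 1\<close> points of
  \<open>L\<close>.\<close>

definition long_lines :: "('i \<Rightarrow> 'a) set set \<Rightarrow> ('i \<Rightarrow> 'a) set set" where
  "long_lines L = {l. V.subspace l \<and> card l = (q ^ t) ^ 2 \<and> q ^ 2 < card {P \<in> L. P \<subseteq> l} * (q - 1) + 1}"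

text \<open>Depends on the lines alone, so that equal lines give equal transversal spaces; that
  those of a graph miss \<open>L\<close> is shown separately in
  \<open>linset_not_in_T\<close>.\<close>

definition transversals :: "('i \<Rightarrow> 'a) set set \<Rightarrow> ('i \<Rightarrow> 'a) set set" where
  "transversals S = {T. V.subspace T \<and> card T = q ^ (t * n) \<and> (\<forall>s\<in>S. s \<inter> T \<noteq> {0})}"

lemma card_subspace_ge:
  fixes X :: "('i \<Rightarrow> 'a) set"
  assumes "X \<noteq> {0}" "V.subspace X"
  shows "q ^ t - 1 \<le> card (X - {0})"
proof -
  obtain v where v: "v \<in> X" "v \<noteq> 0" using assms V.subspace_0 by blast
  then have "V.span {v} \<subseteq> X" using assms by (intro V.span_minimal) auto
  then have "card (V.span {v} - {0}) \<le> card (X - {0})" by (intro card_mono) auto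
  then show ?thesis
    using v(2) by (simp add: card_Diff_singleton V.span_zero card_span_singleton card_field)
qed

text \<open>Every line takes at least one point of \<open>T\<close>, and there are as many lines as
  \<open>T\<close> has points.\<close>

lemma transversal_covered_by_spread:
  assumes T: "T \<in> transversals S"
    and sub_S: "\<And>s. s \<in> S \<Longrightarrow> V.subspace s"
    and disj: "\<And>s s'. s \<in> S \<Longrightarrow> s' \<in> S \<Longrightarrow> s \<noteq> s' \<Longrightarrow> s \<inter> s' = {0}"
    and card_S: "card S * (q ^ t - 1) = q ^ (t * n) - 1"
  shows "T - {0} \<subseteq> \<Union>S"
proof (rule covered_by_counting[where k="q ^ t - 1"])
  have sub: "V.subspace T" using T by (simp add: transversals_def)
  show "0 \<in> T" using V.subspace_0[OF sub] .
  show "card T \<le> card S * (q ^ t - 1) + 1" using T card_S by (simp add: transversals_def)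
  fix s assume s: "s \<in> S"
  then have "s \<inter> T \<noteq> {0}" using T by (simp add: transversals_def)
  then show "q ^ t - 1 \<le> card (s \<inter> T - {0})"
    using V.subspace_inter[OF sub_S[OF s] sub] by (rule card_subspace_ge)
qed (use disj in blast)

end

context semilinear_graph begin

lemma T1_neq_T2: "T1 \<noteq> T2"
proof
  assume "T1 = T2"
  then have "card T1 = 1" using T_disjoint by simp
  then show False using card_T1 q_pow_tn_gt q_less_q_pow_t q_ge_2 by simp
qed

lemma in_lines_cases:
  assumes "X + Y \<in> s" "s \<in> lines" "X \<in> T1" "Y \<in> T2" "X \<noteq> 0"
  shows "Y \<in> V.span {g X}"
proof -
  obtain x where x: "x \<in> T1" "x \<noteq> 0" "s = V.span {x, g x}" using assms by (auto simp: lines_def)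
  have "X \<in> V.span {x}" "Y \<in> V.span {g x}" using in_line_iff[of x X Y] x assms by auto
  then have "V.span {X} = V.span {x}" using x assms by (simp add: span_singleton_eq_iff)
  then have "x \<in> V.span {X}" using V.span_base[of x "{x}"] by simp
  then have "V.span {g x} = V.span {g X}"
    using g_span[OF assms(3) x(1)] x assms by (simp add: span_singleton_eq_iff g_eq_0)
  then show ?thesis using \<open>Y \<in> V.span {g x}\<close> by simp
qed

lemma transversal_covered: "T \<in> transversals lines \<Longrightarrow> T - {0} \<subseteq> \<Union>lines"
  using transversal_covered_by_spread[of T lines] line_card lines_pairwise_disjoint card_lines by blast

text \<open>Every nonzero vector of \<open>T\<close> lies on one of the lines, so its
  \<open>T2\<close>-component is a multiple of \<open>g\<close> of its \<open>T1\<close>-component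
  whenever the latter is nonzero. Apply this to the first vector plus \<open>k\<close> times the
  second. If \<open>a\<close> and \<open>c\<close> are nonzero, then
  \<open>b = l * a ^ (q ^ i)\<close> fixes \<open>l\<close> independently of \<open>k\<close>. If
  also \<open>l \<noteq> 0\<close>, comparing the other coefficients gives
  \<open>k ^ (q ^ i) = k\<close> for all \<open>k\<close>, which is impossible.\<close>

lemma transversal_pair:
  assumes T: "T \<in> transversals lines"
    and xy: "x \<in> T1" "y \<in> T1" "x \<noteq> 0" "y \<notin> V.span {x}"
    and v: "a *s x + b *s g x \<in> T" "c *s y + d *s g y \<in> T"
    and nz: "a \<noteq> 0 \<or> b \<noteq> 0" "c \<noteq> 0 \<or> d \<noteq> 0"
  shows "(a = 0 \<and> c = 0) \<or> (b = 0 \<and> d = 0)"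
proof -
  have sub: "V.subspace T" using T by (simp add: transversals_def)
  have y0: "y \<noteq> 0" using xy(4) V.span_zero by metis
  have gx0: "g x \<noteq> 0" using g_eq_0 xy by simp
  have gyx: "g y \<notin> V.span {g x}" using g_span xy by blast
  note sc1 = V.subspace_scale[OF T1] and sc2 = V.subspace_scale[OF T2]
    and ad1 = V.subspace_add[OF T1] and ad2 = V.subspace_add[OF T2]
  have key: "\<exists>l. b = l * a ^ (q ^ i) \<and> k * d = l * (k ^ (q ^ i) * c ^ (q ^ i))"
    if k: "a *s x + (k * c) *s y \<noteq> 0" for k
  proof -
    have "(a *s x + b *s g x) + k *s (c *s y + d *s g y) \<in> T"
      using v V.subspace_add[OF sub] V.subspace_scale[OF sub] by blast
    then have inT: "(a *s x + (k * c) *s y) + (b *s g x + (k * d) *s g y) \<in> T" (is "?X + ?Y \<in> T")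
      by (simp add: V.scale_right_distrib algebra_simps)
    have X: "?X \<in> T1" and Y: "?Y \<in> T2" using xy g_in by (simp_all add: sc1 sc2 ad1 ad2)
    have "?X + ?Y \<noteq> 0"
    proof
      assume "?X + ?Y = 0"
      then have "?X + ?Y = 0 + 0" by simp
      then show False using sum_unique(1)[OF X V.subspace_0[OF T1] Y V.subspace_0[OF T2]] k by blast
    qed
    then obtain s where "s \<in> lines" "?X + ?Y \<in> s" using transversal_covered[OF T] inT by blast
    then have "?Y \<in> V.span {g ?X}" using in_lines_cases X Y k by blast
    then obtain l where "?Y = l *s g ?X" by (auto simp: in_span_singleton)
    also have "g ?X = a ^ (q ^ i) *s g x + (k ^ (q ^ i) * c ^ (q ^ i)) *s g y"
      using xy by (simp add: g_add sc1 g_scale power_mult_distrib)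
    finally have eq: "b *s g x + (k * d) *s g y = (l * a ^ (q ^ i)) *s g x + (l * (k ^ (q ^ i) * c ^ (q ^ i))) *s g y"
      by (simp only: V.scale_right_distrib V.scale_scale)
    show ?thesis using indep2_coeffs[OF gx0 gyx eq] by blast
  qed
  have z: "(0::'a) ^ (q ^ i) = 0" by (rule frob_zero)
  have key_nz: "a *s x + (k * c) *s y \<noteq> 0" if "a \<noteq> 0 \<or> k * c \<noteq> 0" for k
  proof
    assume "a *s x + (k * c) *s y = 0"
    then have "a *s x + (k * c) *s y = 0 *s x + 0 *s y" by simp
    from indep2_coeffs[OF xy(3,4) this] show False using that by simp
  qed
  show ?thesis
  proof (cases "a = 0")
    case True
    then have "b \<noteq> 0" using nz by simp
    moreover have "c \<noteq> 0 \<Longrightarrow> b = 0" using key[OF key_nz, of 1] True z by auto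
    ultimately show ?thesis using True by blast
  next
    case a: False
    show ?thesis
    proof (cases "c = 0")
      case True
      then have "d = 0" using key[OF key_nz, of 1] a z by auto
      then show ?thesis using nz True by simp
    next
      case c: False
      have fa: "a ^ (q ^ i) \<noteq> 0" and fc: "c ^ (q ^ i) \<noteq> 0" using a c by simp_all
      obtain l where l: "b = l * a ^ (q ^ i)" "d = l * c ^ (q ^ i)"
        using key[OF key_nz, of 1] a by auto
      show ?thesis
      proof (cases "l = 0")
        case True
        then show ?thesis using l by simp
      next
        case False
        have "k ^ (q ^ i) = k" for k :: 'a
        proof -
          obtain l' where l': "b = l' * a ^ (q ^ i)" "k * d = l' * (k ^ (q ^ i) * c ^ (q ^ i))"
            using key[OF key_nz, of k] a by auto
          then have ll: "l' = l" using l(1) fa by (metis mult_right_cancel)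
          have "l * c ^ q ^ i \<noteq> 0" using False fc by (metis mult_eq_0_iff)
          moreover have "k * (l * c ^ q ^ i) = k ^ q ^ i * (l * c ^ q ^ i)"
            using l'(2) by (simp only: ll l(2) mult.left_commute)
          ultimately show ?thesis by (metis mult_right_cancel)
        qed
        then show ?thesis using frob_not_all_fixed[OF coprime_i] by blast
      qed
    qed
  qed
qed

lemma exists_T1_nonzero: "\<exists>x\<in>T1. x \<noteq> 0"
  using exists_outside_span[OF card_T1, of 0] by auto

text \<open>By \<open>transversal_pair\<close> the vector in which \<open>T\<close> meets one line
  lies in \<open>T1\<close> or in \<open>T2\<close>, and the same alternative then holds on all
  lines. So \<open>T\<close> contains one of the two spaces and equals it by cardinality.\<close>

lemma transversals_lines: "transversals lines = {T1, T2}"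
proof
  show "{T1, T2} \<subseteq> transversals lines"
  proof -
    have "s \<inter> T1 \<noteq> {0}" "s \<inter> T2 \<noteq> {0}" if s: "s \<in> lines" for s
    proof -
      obtain x where x: "x \<in> T1" "x \<noteq> 0" "s = V.span {x, g x}" using s by (auto simp: lines_def)
      then have "x \<in> s \<inter> T1" "g x \<in> s \<inter> T2" "g x \<noteq> 0"
        using g_in g_eq_0 by (simp_all add: V.span_base)
      then show "s \<inter> T1 \<noteq> {0}" "s \<inter> T2 \<noteq> {0}" using x by auto
    qed
    then show ?thesis by (simp add: transversals_def T1 T2 card_T1 card_T2)
  qed
  show "transversals lines \<subseteq> {T1, T2}"
  proof
    fix T assume T: "T \<in> transversals lines"
    then have sub: "V.subspace T" and card_T: "card T = q ^ (t * n)" by (simp_all add: transversals_def)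
    have ex: "\<exists>a b. a *s x + b *s g x \<in> T \<and> (a \<noteq> 0 \<or> b \<noteq> 0)" if "x \<in> T1" "x \<noteq> 0" for x
    proof -
      have "V.span {x, g x} \<inter> T \<noteq> {0}" using T that by (auto simp: transversals_def lines_def)
      then obtain v where v: "v \<in> V.span {x, g x}" "v \<in> T" "v \<noteq> 0"
        using V.span_zero V.subspace_0[OF sub] by blast
      then obtain a b where ab: "v = a *s x + b *s g x" by (auto simp: in_span_pair)
      then have "a \<noteq> 0 \<or> b \<noteq> 0" using v by auto
      then show ?thesis using v ab by blast
    qed
    obtain x where x: "x \<in> T1" "x \<noteq> 0" using exists_T1_nonzero by blast
    obtain a b where ab: "a *s x + b *s g x \<in> T" "a \<noteq> 0 \<or> b \<noteq> 0" using ex x by blast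
    have imp: "u \<in> T" if "k *s u \<in> T" "k \<noteq> 0" for u k
    proof -
      have "inverse k *s k *s u \<in> T" using V.subspace_scale[OF sub that(1)] .
      then show ?thesis using that(2) by simp
    qed
    have out: "(a = 0 \<and> g y \<in> T) \<or> (b = 0 \<and> y \<in> T)" if y: "y \<in> T1" "y \<notin> V.span {x}" for y
    proof -
      have "y \<noteq> 0" using y V.span_zero by metis
      then obtain c d where cd: "c *s y + d *s g y \<in> T" "c \<noteq> 0 \<or> d \<noteq> 0" using ex y by blast
      show ?thesis
        using transversal_pair[OF T x(1) y(1) x(2) y(2) ab(1) cd(1) ab(2) cd(2)] cd imp by auto
    qed
    have inside: "(a = 0 \<longrightarrow> g y \<in> T) \<and> (b = 0 \<longrightarrow> y \<in> T)" if y: "y \<in> V.span {x}" for y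
    proof -
      obtain c where c: "y = c *s x" using y by (auto simp: in_span_singleton)
      have "k *s u \<in> T" if "l *s u \<in> T" "l \<noteq> 0" for u k l
        using V.subspace_scale[OF sub imp[OF that]] .
      then show ?thesis using ab x by (auto simp: c g_scale)
    qed
    \<comment> \<open>Only the comparison with a vector off the line of \<open>x\<close> shows that
      one of \<open>a\<close> and \<open>b\<close> vanishes.\<close>
    obtain y0 where y0: "y0 \<in> T1" "y0 \<notin> V.span {x}" using exists_outside_span[OF card_T1] by blast
    show "T \<in> {T1, T2}"
    proof (cases "a = 0")
      case True
      then have "g y \<in> T" if "y \<in> T1" for y using out inside ab that by blast
      then have "T2 \<subseteq> T" using g_surj by blast
      then show ?thesis using card_T card_T2 card_seteq[of T T2] by simp
    next
      case False
      then have "b = 0" using out[OF y0] by blast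
      then have "y \<in> T" if "y \<in> T1" for y using out inside False that by blast
      then have "T1 \<subseteq> T" by blast
      then show ?thesis using card_T card_T1 card_seteq[of T T1] by simp
    qed
  qed
qed

lemma linset_not_in_T:
  assumes "P \<in> linset graph"
  shows "\<not> P \<subseteq> T1" "\<not> P \<subseteq> T2"
proof -
  obtain x where x: "x \<in> T1" "x + g x \<noteq> 0" "P = V.span {x + g x}"
    using assms by (auto simp: linset_eq graph_def)
  have P: "x + g x \<in> P" using x V.span_base by blast
  have x0: "x \<noteq> 0" using x g_zero by auto
  have z: "0 \<in> T1" "0 \<in> T2" using T1 T2 V.subspace_0 by blast+
  show "\<not> P \<subseteq> T1"
  proof
    assume "P \<subseteq> T1"
    then have "g x = 0" using sum_unique(2)[OF x(1) _ g_in[OF x(1)] z(2), of "x + g x"] P by auto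
    then show False using g_eq_0 x x0 by blast
  qed
  show "\<not> P \<subseteq> T2"
  proof
    assume "P \<subseteq> T2"
    then have "x = 0" using sum_unique(1)[OF x(1) z(1) g_in[OF x(1)], of "x + g x"] P by auto
    then show False using x0 by blast
  qed
qed

lemma pseudoregulus_type_linset_graph: "pseudoregulus_type q t n (linset graph)"
  unfolding pseudoregulus_type_def
proof (intro exI[of _ graph] conjI exI[of _ lines])
  show "subsp (subfieldq q) graph" by (rule graph_subsp)
  show "scattered q graph" unfolding scattered_def weight_def
  proof
    fix P assume "P \<in> linset graph"
    then obtain u where u: "u \<in> graph" "u \<noteq> 0" "P = V.span {u}" by (auto simp: linset_eq)
    have "subsp (subfieldq q) (P \<inter> graph)"
      using u graph_subsp subsp_of_subspace[OF V.subspace_span] by (intro subsp_Int) auto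
    then show "dimK (subfieldq q) (P \<inter> graph) = 1"
      using card_span_graph[OF u(1,2)] u by (simp add: dimK_subfieldq_eq_iff)
  qed
  show "dimK (subfieldq q) graph = t * n"
    using graph_subsp card_graph by (simp add: dimK_subfieldq_eq_iff)
  have "q ^ t - 1 > 0" using q_less_q_pow_t q_ge_2 by simp
  then show "card lines = (q ^ (n * t) - 1) div (q ^ t - 1)"
    using card_lines by (metis div_mult_self_is_m mult.commute)
  show "\<forall>s\<in>lines. proj_line s \<and> weight q graph s = t"
  proof
    fix s assume s: "s \<in> lines"
    then have "subsp (subfieldq q) (s \<inter> graph)"
      using line_card graph_subsp subsp_of_subspace by (intro subsp_Int) auto
    then show "proj_line s \<and> weight q graph s = t"
      using line_card[OF s] card_line_graph[OF s] unfolding proj_line_def weight_def subsp_UNIV_eq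
      by (simp add: dimK_UNIV_eq_iff dimK_subfieldq_eq_iff)
  qed
  show "\<forall>s\<in>lines. \<forall>s'\<in>lines. s \<noteq> s' \<longrightarrow> s \<inter> s' = {vzero}"
    using lines_pairwise_disjoint by (simp add: vzero_eq_0)
  have "{T. subsp UNIV T \<and> dimK UNIV T = n \<and> (\<forall>P\<in>linset graph. \<not> P \<subseteq> T) \<and> (\<forall>s\<in>lines. s \<inter> T \<noteq> {vzero})}
      = {T \<in> transversals lines. \<forall>P\<in>linset graph. \<not> P \<subseteq> T}"
    unfolding transversals_def subsp_UNIV_eq vzero_eq_0
    using dimK_UNIV_eq_iff[of _ n] by (auto simp: power_mult)
  also have "\<dots> = {T1, T2}" unfolding transversals_lines using linset_not_in_T by auto
  finally show "card {T. subsp UNIV T \<and> dimK UNIV T = n \<and> (\<forall>P\<in>linset graph. \<not> P \<subseteq> T) \<and> (\<forall>s\<in>lines. s \<inter> T \<noteq> {vzero})} = 2"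
    using T1_neq_T2 by simp
qed (rule refl)

lemma graph_zero: "0 \<in> graph"
  using graph_subsp by (simp add: subsp_iff)

lemma card_points_in_subspace:
  assumes "V.subspace l"
  shows "card {P \<in> linset graph. P \<subseteq> l} * (q - 1) + 1 = card (graph \<inter> l)"
proof -
  have sp: "V.span {x} \<subseteq> l \<longleftrightarrow> x \<in> l" for x
    using assms V.span_minimal[of "{x}" l] V.span_base[of x "{x}"] by blast
  have "{P \<in> linset graph. P \<subseteq> l} = (\<lambda>x. V.span {x}) ` (graph \<inter> l - {0})"
    unfolding linset_eq using sp by blast
  moreover have "card ((\<lambda>x. V.span {x}) ` (graph \<inter> l - {0})) * (q - 1) = card (graph \<inter> l) - 1"
  proof (rule card_points_subset)
    fix x assume x: "x \<in> graph \<inter> l - {0}"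
    then have "V.span {x} \<inter> (graph \<inter> l) = V.span {x} \<inter> graph" using sp[of x] by blast
    then show "card (V.span {x} \<inter> (graph \<inter> l)) = q" using card_span_graph x by simp
  qed (simp add: graph_zero V.subspace_0[OF assms])
  moreover have "card (graph \<inter> l) > 0"
    using graph_zero V.subspace_0[OF assms] by (auto simp: card_gt_0_iff)
  ultimately show ?thesis by simp
qed

text \<open>A line meeting the graph in independent vectors over independent \<open>x\<close>, \<open>y\<close> has weight at most 2;
  since \<open>t \<ge> 3\<close>, this separates it from the lines \<open>\<langle>x, g x\<rangle>\<close>, which have weight \<open>t\<close>.\<close>
lemma heavy_line:
  assumes l: "V.subspace l" "card l = (q ^ t) ^ 2" and heavy: "q ^ 2 < card (graph \<inter> l)"
  shows "l \<in> lines"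
proof -
  have "q \<le> q ^ 2" by (simp add: power2_nat_le_imp_le power2_eq_square)
  then have "q < card (graph \<inter> l)" using heavy by simp
  have "\<not> graph \<inter> l \<subseteq> {0}"
    using \<open>q < card (graph \<inter> l)\<close> q_ge_2 card_mono[of "{0}" "graph \<inter> l"] by auto
  then obtain u where u: "u \<in> graph" "u \<in> l" "u \<noteq> 0" by blast
  have "\<not> graph \<inter> l \<subseteq> V.span {u} \<inter> graph"
    using \<open>q < card (graph \<inter> l)\<close> card_span_graph[OF u(1,3)] card_mono[of "V.span {u} \<inter> graph" "graph \<inter> l"] by auto
  \<comment> \<open>More than \<open>q\<close> vectors do not fit into one point of the graph, so
    \<open>l\<close> is spanned by two vectors of the graph.\<close>
  then obtain v where v: "v \<in> graph" "v \<in> l" "v \<notin> V.span {u}" by blast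
  have l_eq: "l = V.span {u, v}"
    using subspace_line_eq[OF l(1) _ u(2) v(2) u(3) v(3)] l(2) by (simp add: card_field)
  obtain x where x: "x \<in> T1" "u = x + g x" using u by (auto simp: graph_def)
  obtain y where y: "y \<in> T1" "v = y + g y" using v by (auto simp: graph_def)
  have x0: "x \<noteq> 0" using x u g_zero by auto
  show ?thesis
  proof (cases "y \<in> V.span {x}")
    case True
    then have "g y \<in> V.span {g x}" using g_span x y by blast
    then have "u \<in> V.span {x, g x}" "v \<in> V.span {x, g x}"
      using in_line_iff[OF x(1)] x y g_in True by (simp_all add: V.span_base)
    moreover have "V.span {x, g x} \<in> lines" using x x0 by (auto simp: lines_def)
    ultimately show ?thesis
      using subspace_line_eq[of "V.span {x, g x}" u v] line_card[of "V.span {x, g x}"] u v l_eq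
      by (simp add: card_field)
  next
    case False
    note gyx = False[folded g_span[OF x(1) y(1)]]
    have gx0: "g x \<noteq> 0" using g_eq_0 x x0 by blast
    note sc1 = V.subspace_scale[OF T1] and sc2 = V.subspace_scale[OF T2]
    have "graph \<inter> l \<subseteq> (\<lambda>(a, b). a *s u + b *s v) ` (subfieldq q \<times> subfieldq q)"
    proof
      fix z assume z: "z \<in> graph \<inter> l"
      then obtain a b where ab: "z = a *s u + b *s v" using l_eq by (auto simp: in_span_pair)
      then have eq: "z = (a *s x + b *s y) + (a *s g x + b *s g y)"
        using x y by (simp add: V.scale_right_distrib algebra_simps)
      have "a *s x + b *s y \<in> T1" "a *s g x + b *s g y \<in> T2"
        using x y g_in sc1 sc2 V.subspace_add[OF T1] V.subspace_add[OF T2] by auto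
      then have "a *s g x + b *s g y = g (a *s x + b *s y)" using sum_in_graph eq z by auto
      also have "\<dots> = a ^ (q ^ i) *s g x + b ^ (q ^ i) *s g y"
        using x y sc1 by (simp add: g_add g_scale)
      finally have "a *s g x + b *s g y = a ^ (q ^ i) *s g x + b ^ (q ^ i) *s g y" .
      from indep2_coeffs[OF gx0 gyx this] have "a \<in> subfieldq q" "b \<in> subfieldq q"
        using frob_fix_iff[OF coprime_i] by metis+
      then show "z \<in> (\<lambda>(a, b). a *s u + b *s v) ` (subfieldq q \<times> subfieldq q)" using ab by force
    qed
    then have "card (graph \<inter> l) \<le> card ((\<lambda>(a, b). a *s u + b *s v) ` (subfieldq q \<times> subfieldq q))"
      by (intro card_mono) auto
    also have "\<dots> \<le> card ((subfieldq q :: 'a set) \<times> (subfieldq q :: 'a set))" by (rule card_image_le) simp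
    also have "\<dots> = q ^ 2" by (simp add: card_cartesian_product card_subfieldq power2_eq_square)
    finally show ?thesis using heavy by simp
  qed
qed

text \<open>The right-hand side mentions only the linear set, so all graphs that define the same
  linear set share their lines.\<close>

lemma lines_eq_long_lines: "lines = long_lines (linset graph)"
proof -
  have "q ^ 2 < q ^ t" using q_ge_2 t_ge_3 by (intro power_strict_increasing) auto
  then show ?thesis
    unfolding long_lines_def using heavy_line line_card card_line_graph card_points_in_subspace
    by (auto simp: Int_commute)
qed

text \<open>The inverse of \<open>g\<close> is semilinear for the inverse automorphism, whose
  exponent is \<open>t - i\<close>; in the graph only the two summands change places.\<close>

lemma swap_semilinear_graph:
  assumes "i < t"
  shows "semilinear_graph q t n (t - i) T2 T1 (inv_into T1 g)"
    and "semilinear_graph.graph T2 (inv_into T1 g) = graph"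
proof -
  let ?h = "inv_into T1 g"
  have h: "?h y \<in> T1" "g (?h y) = y" if "y \<in> T2" for y
    using that g_bij by (auto simp: bij_betw_def inv_into_into f_inv_into_f)
  have hg: "?h (g x) = x" if "x \<in> T1" for x
    using that g_bij by (simp add: bij_betw_def inv_into_f_f)
  show sg: "semilinear_graph q t n (t - i) T2 T1 ?h"
  proof unfold_locales
    show "coprime (t - i) t"
      using coprime_i assms by (metis coprime_commute coprime_diff_one_right_nat gcd_diff1_nat coprime_iff_gcd_eq_1 gcd.commute less_imp_le gcd_diff2_nat)
    show "V.subspace T2" "V.subspace T1" "card T2 = q ^ (t * n)" "card T1 = q ^ (t * n)"
      by (fact T1 T2 card_T1 card_T2)+
    show "T2 \<inter> T1 = {0}" using T_disjoint by blast
    show "bij_betw ?h T2 T1" using g_bij by (rule bij_betw_inv_into)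
    show "?h (x + y) = ?h x + ?h y" if "x \<in> T2" "y \<in> T2" for x y
      using g_inj[of "?h (x + y)" "?h x + ?h y"] that h V.subspace_add[OF T1] V.subspace_add[OF T2]
      by (simp add: g_add)
    show "?h (c *s x) = c ^ (q ^ (t - i)) *s ?h x" if "x \<in> T2" for c x
    proof (rule g_inj)
      have "(c ^ q ^ (t - i)) ^ q ^ i = c" using frob_frob[of c "t - i" i] frob_t assms by simp
      then show "g (?h (c *s x)) = g (c ^ (q ^ (t - i)) *s ?h x)"
        using that h V.subspace_scale[OF T2] by (simp add: g_scale)
    qed (use that h V.subspace_scale[OF T2] V.subspace_scale[OF T1] in auto)
  qed
  then interpret S: semilinear_graph q t TY n IY "t - i" T2 T1 ?h .
  show "S.graph = graph"
    unfolding S.graph_def graph_def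
  proof safe
    fix y assume "y \<in> T2"
    then show "y + ?h y \<in> (\<lambda>x. x + g x) ` T1" using h[of y] by (intro image_eqI[of _ _ "?h y"]) (auto simp: add.commute)
  next
    fix x assume "x \<in> T1"
    then show "x + g x \<in> (\<lambda>x. x + ?h x) ` T2" using hg[of x] g_in by (intro image_eqI[of _ _ "g x"]) (auto simp: add.commute)
  qed
qed

end

subsection \<open>Types of linear sets and collineations\<close>

context ambient begin

text \<open>Equal lines make \<open>h\<close> proportional to \<open>g\<close> at every point, and
  additivity makes the factor equal at independent vectors. Through an auxiliary \<open>y\<close>
  the factors at \<open>x\<close> and \<open>c *s x\<close> agree too, and evaluating both maps at
  \<open>c *s x\<close> equates the two powers of \<open>c\<close>.\<close>

lemma same_transversals_imp_same_type:
  fixes T1 T2 :: "('i \<Rightarrow> 'a) set"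
  assumes "semilinear_graph q t n i T1 T2 g" "semilinear_graph q t n j T1 T2 h"
    and lines: "semilinear_graph.lines T1 g = semilinear_graph.lines T1 h"
    and "i < t" "j < t"
  shows "i = j"
proof -
  interpret A: semilinear_graph q t TY n IY i T1 T2 g by fact
  interpret B: semilinear_graph q t TY n IY j T1 T2 h by fact
  have "\<exists>l. h x = l *s g x" if x: "x \<in> T1" "x \<noteq> 0" for x
  proof -
    have "V.span {x, g x} \<in> A.lines" "V.span {x, h x} \<in> A.lines"
      using x lines by (auto simp: A.lines_def B.lines_def)
    moreover have "x \<in> V.span {x, g x} \<inter> V.span {x, h x}" by (simp add: V.span_base)
    ultimately have "V.span {x, g x} = V.span {x, h x}"
      using A.lines_pairwise_disjoint x(2) by blast
    then have "0 + h x \<in> V.span {x, g x}" using V.span_base[of "h x" "{x, h x}"] by simp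
    then have "h x \<in> V.span {g x}"
      using A.in_line_iff[OF x(1) V.subspace_0[OF A.T1] B.g_in[OF x(1)]] by simp
    then show ?thesis by (auto simp: in_span_singleton)
  qed
  then obtain l where l: "\<And>x. x \<in> T1 \<Longrightarrow> x \<noteq> 0 \<Longrightarrow> h x = l x *s g x" by metis
  have const: "l x = l y" if xy: "x \<in> T1" "y \<in> T1" "x \<noteq> 0" "y \<notin> V.span {x}" for x y
  proof -
    have y0: "y \<noteq> 0" using xy V.span_zero by metis
    have s0: "x + y \<noteq> 0"
    proof
      assume "x + y = 0"
      then have "y = (-1) *s x" by (simp add: eq_neg_iff_add_eq_0 add.commute)
      then show False using xy in_span_singleton by blast
    qed
    have gx0: "g x \<noteq> 0" and gyx: "g y \<notin> V.span {g x}"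
      using A.g_eq_0 A.g_span xy by simp_all
    have "h (x + y) = l (x + y) *s g x + l (x + y) *s g y"
      using l[OF V.subspace_add[OF A.T1 xy(1,2)] s0] xy by (simp add: A.g_add V.scale_right_distrib)
    moreover have "h (x + y) = l x *s g x + l y *s g y"
      using l xy y0 by (simp add: B.g_add)
    ultimately have eq: "l x *s g x + l y *s g y = l (x + y) *s g x + l (x + y) *s g y" by simp
    show ?thesis using indep2_coeffs[OF gx0 gyx eq] by simp
  qed
  obtain x where x: "x \<in> T1" "x \<noteq> 0" using A.exists_T1_nonzero by blast
  obtain y where y: "y \<in> T1" "y \<notin> V.span {x}" using exists_outside_span[OF A.card_T1] by blast
  have gx0: "g x \<noteq> 0" using A.g_eq_0 x by simp
  have lx: "l x \<noteq> 0" using l[OF x] B.g_eq_0 x by auto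
  have "c ^ (q ^ i) = c ^ (q ^ j)" for c :: 'a
  proof (cases "c = 0")
    case True
    then show ?thesis by (simp only: frob_zero)
  next
    case False
    have cx: "c *s x \<in> T1" "c *s x \<noteq> 0" using x False V.subspace_scale[OF A.T1] by auto
    have "V.span {c *s x} = V.span {x}"
      using cx x in_span_singleton by (subst span_singleton_eq_iff) blast+
    then have "l (c *s x) = l y" using const[OF cx(1) y(1) cx(2)] y by simp
    also have "\<dots> = l x" using const[OF x(1) y(1) x(2) y(2)] by simp
    finally have "l x *s c ^ (q ^ i) *s g x = c ^ (q ^ j) *s l x *s g x"
      using l[OF cx] l[OF x] A.g_scale[OF x(1)] B.g_scale[OF x(1)] by metis
    then have "(l x * c ^ (q ^ i)) *s g x = (l x * c ^ (q ^ j)) *s g x"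
      by (simp only: V.scale_scale mult.commute)
    then have "l x * c ^ (q ^ i) = l x * c ^ (q ^ j)" using gx0 V.scale_right_imp_eq by blast
    then show ?thesis using lx by (metis mult_left_cancel)
  qed
  then show ?thesis using frob_eq_imp_eq assms(4,5) by blast
qed

definition has_type :: "nat \<Rightarrow> ('i \<Rightarrow> 'a) set set \<Rightarrow> bool" where
  "has_type i L \<longleftrightarrow> (\<exists>T1 T2 g. semilinear_graph q t n i T1 T2 g \<and> L = linset (semilinear_graph.graph T1 g))"

lemma has_type_swap: "has_type i L \<Longrightarrow> i < t \<Longrightarrow> has_type (t - i) L"
  unfolding has_type_def using semilinear_graph.swap_semilinear_graph by metis

lemma has_type_unique:
  assumes "has_type i L" "has_type j L" "i < t" "j < t"
  shows "j = i \<or> j = t - i"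
proof -
  obtain T1 T2 g where A: "semilinear_graph q t n i T1 T2 g" "L = linset (semilinear_graph.graph T1 g)"
    using assms(1) by (auto simp: has_type_def)
  obtain T1' T2' h where B: "semilinear_graph q t n j T1' T2' h" "L = linset (semilinear_graph.graph T1' h)"
    using assms(2) by (auto simp: has_type_def)
  interpret A: semilinear_graph q t TY n IY i T1 T2 g by fact
  interpret B: semilinear_graph q t TY n IY j T1' T2' h by fact
  have lines: "A.lines = B.lines"
    using A.lines_eq_long_lines B.lines_eq_long_lines A(2) B(2) by simp
  then have "{T1, T2} = {T1', T2'}"
    using A.transversals_lines B.transversals_lines by simp
  then consider "T1' = T1" "T2' = T2" | "T1' = T2" "T2' = T1" by (auto simp: doubleton_eq_iff)
  then show ?thesis
  proof cases
    case 1
    then show ?thesis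
      using same_transversals_imp_same_type[OF A(1) B(1)[unfolded 1]] lines assms(3,4) 1 by simp
  next
    case 2
    note C = A.swap_semilinear_graph[OF assms(3)]
    interpret C: semilinear_graph q t TY n IY "t - i" T2 T1 "inv_into T1 g" by (rule C(1))
    have "C.lines = B.lines"
      using C.lines_eq_long_lines B.lines_eq_long_lines C(2) A(2) B(2) by simp
    \<comment> \<open>Coprimality excludes \<open>i = 0\<close>, for which \<open>t - i\<close>
      would not be a reduced exponent.\<close>
    moreover have "t - i < t"
    proof -
      have "i \<noteq> 0" using A.coprime_i t_ge_3 by (cases i) auto
      then show ?thesis using assms(3) by simp
    qed
    ultimately show ?thesis
      using same_transversals_imp_same_type[OF C(1) B(1)[unfolded 2]] assms(4) 2 by simp
  qed
qed

lemma has_type_imp_pseudoregulus_type: "has_type i L \<Longrightarrow> pseudoregulus_type q t n L"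
  unfolding has_type_def using semilinear_graph.pseudoregulus_type_linset_graph by blast

lemma has_type_collineation:
  assumes "has_type i L" "collineation f"
  shows "has_type i (f ` L)"
proof -
  obtain T1 T2 g where A: "semilinear_graph q t n i T1 T2 g" "L = linset (semilinear_graph.graph T1 g)"
    using assms(1) by (auto simp: has_type_def)
  interpret A: semilinear_graph q t TY n IY i T1 T2 g by fact
  have dim: "card (UNIV :: 'i set) \<ge> 3" using card_index n_ge_2 by simp
  obtain \<phi> s where add: "\<And>u v. \<phi> (u + v) = \<phi> u + \<phi> v"
    and scale: "\<And>c v. \<phi> (c *s v) = s c *s \<phi> v" and bij: "bij \<phi>"
    and s_mult: "\<And>c d. s (c * d) = s c * s d" and s_one: "s 1 = 1" and bij_s: "bij s"
    and f: "\<And>v. v \<noteq> 0 \<Longrightarrow> f (V.span {v}) = V.span {\<phi> v}"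
    by (rule fundamental_theorem_projective_geometry[OF assms(2) dim]) (rule that)
  have zero: "\<phi> 0 = 0" using add[of 0 0] by simp
  have inj: "\<phi> u = \<phi> v \<longleftrightarrow> u = v" for u v using bij by (meson bij_is_inj injD)
  have nz: "\<phi> v = 0 \<longleftrightarrow> v = 0" for v using inj[of v 0] by (simp add: zero)
  have s_pow: "s (c ^ k) = s c ^ k" for c k by (induction k) (simp_all add: s_one s_mult)
  define \<psi> where "\<psi> = inv_into UNIV \<phi>"
  have \<psi>: "\<psi> (\<phi> v) = v" "\<phi> (\<psi> v) = v" for v
    using bij by (simp_all add: \<psi>_def bij_is_inj bij_is_surj surj_f_inv_f)
  have sub: "V.subspace (\<phi> ` T)" if T: "V.subspace T" for T
    unfolding V.subspace_def
  proof (intro conjI ballI allI)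
    show "0 \<in> \<phi> ` T" using V.subspace_0[OF T] zero by force
    show "x + y \<in> \<phi> ` T" if xy: "x \<in> \<phi> ` T" "y \<in> \<phi> ` T" for x y
    proof -
      obtain u v where "u \<in> T" "v \<in> T" "x = \<phi> u" "y = \<phi> v" using xy by blast
      then show ?thesis using V.subspace_add[OF T] by (metis add imageI)
    qed
    show "c *s x \<in> \<phi> ` T" if x: "x \<in> \<phi> ` T" for c x
    proof -
      obtain u where "u \<in> T" "x = \<phi> u" using x by blast
      moreover obtain d where "s d = c" using surjD[OF bij_is_surj[OF bij_s], of c] by metis
      ultimately show ?thesis using V.subspace_scale[OF T, of u d] by (metis scale imageI)
    qed
  qed
  \<comment> \<open>The conjugate of \<open>g\<close> by \<open>\<phi>\<close>. Its exponent is
    still \<open>i\<close>, because the multiplicative map \<open>s\<close> commutes with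
    powers.\<close>
  let ?h = "\<lambda>v. \<phi> (g (\<psi> v))"
  have card: "card (\<phi> ` T) = card T" for T
    using bij by (intro card_image) (auto simp: bij_def intro: inj_on_subset)
  have sg: "semilinear_graph q t n i (\<phi> ` T1) (\<phi> ` T2) ?h"
  proof unfold_locales
    show "coprime i t" by (rule A.coprime_i)
    show "V.subspace (\<phi> ` T1)" "V.subspace (\<phi> ` T2)" using A.T1 A.T2 sub by blast+
    show "card (\<phi> ` T1) = q ^ (t * n)" "card (\<phi> ` T2) = q ^ (t * n)"
      by (simp_all add: card A.card_T1 A.card_T2)
    show "\<phi> ` T1 \<inter> \<phi> ` T2 = {0}"
      using A.T_disjoint bij by (simp add: bij_is_inj zero flip: image_Int)
    show "bij_betw ?h (\<phi> ` T1) (\<phi> ` T2)"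
    proof (rule bij_betw_imageI)
      show "inj_on ?h (\<phi> ` T1)" using A.g_inj by (auto intro!: inj_onI simp: \<psi> inj)
      show "?h ` \<phi> ` T1 = \<phi> ` T2"
        using A.g_bij by (simp add: image_image \<psi> bij_betw_def flip: image_image[of \<phi> g])
    qed
    show "?h (x + y) = ?h x + ?h y" if xy: "x \<in> \<phi> ` T1" "y \<in> \<phi> ` T1" for x y
    proof -
      obtain u v where "u \<in> T1" "v \<in> T1" "x = \<phi> u" "y = \<phi> v" using xy by blast
      then show ?thesis by (simp add: \<psi> A.g_add flip: add)
    qed
    show "?h (c *s x) = c ^ (q ^ i) *s ?h x" if x: "x \<in> \<phi> ` T1" for c x
    proof -
      obtain u where u: "u \<in> T1" "x = \<phi> u" using x by blast
      obtain d where d: "s d = c" using surjD[OF bij_is_surj[OF bij_s], of c] by metis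
      have "?h (c *s x) = \<phi> (g (d *s u))" using u d by (metis \<psi>(1) scale)
      also have "\<dots> = c ^ (q ^ i) *s \<phi> (g u)" using u d by (simp add: A.g_scale scale s_pow)
      finally show ?thesis using u by (simp add: \<psi>)
    qed
  qed
  then interpret B: semilinear_graph q t TY n IY i "\<phi> ` T1" "\<phi> ` T2" ?h .
  have "B.graph = \<phi> ` A.graph"
    by (simp add: B.graph_def A.graph_def image_image \<psi> add)
  moreover have "f ` linset A.graph = linset (\<phi> ` A.graph)"
  proof -
    have "\<phi> ` A.graph - {0} = \<phi> ` (A.graph - {0})" using nz by auto
    then show ?thesis unfolding linset_eq image_image using f by (simp add: image_image)
  qed
  ultimately show ?thesis unfolding has_type_def using sg A(2) by metis
qed

text \<open>A linear isomorphism \<open>k\<close> from \<open>T1\<close> onto \<open>S1\<close>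
  dictates the rest, since \<open>g x\<close> has to go to \<open>h (k x)\<close>. The resulting map
  on \<open>T2\<close> undoes \<open>g\<close> and then applies \<open>k\<close> and
  \<open>h\<close>; equal exponents make the two automorphisms cancel, so it is linear.\<close>

lemma has_type_equivalent:
  assumes "has_type i L" "has_type i L'"
  shows "\<exists>f. collineation f \<and> f ` L = L'"
proof -
  obtain T1 T2 g where A: "semilinear_graph q t n i T1 T2 g" "L = linset (semilinear_graph.graph T1 g)"
    using assms(1) by (auto simp: has_type_def)
  obtain S1 S2 h where B: "semilinear_graph q t n i S1 S2 h" "L' = linset (semilinear_graph.graph S1 h)"
    using assms(2) by (auto simp: has_type_def)
  interpret A: semilinear_graph q t TY n IY i T1 T2 g by fact
  interpret B: semilinear_graph q t TY n IY i S1 S2 h by fact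
  obtain Bas where Bas: "V.independent Bas" "V.span Bas = (UNIV :: ('i \<Rightarrow> 'a) set)"
    using V.basis_exists[of "UNIV :: ('i \<Rightarrow> 'a) set"] by (metis V.span_UNIV top.extremum_unique)
  interpret F: finite_dimensional_vector_space "smul :: 'a \<Rightarrow> ('i \<Rightarrow> 'a) \<Rightarrow> _" Bas
    using Bas by unfold_locales simp_all
  interpret FP: finite_dimensional_vector_space_pair "smul :: 'a \<Rightarrow> ('i \<Rightarrow> 'a) \<Rightarrow> _" Bas "smul :: 'a \<Rightarrow> ('i \<Rightarrow> 'a) \<Rightarrow> _" Bas ..
  have "card (UNIV :: 'a set) ^ V.dim T1 = card (UNIV :: 'a set) ^ V.dim S1"
    using card_subspace_eq_power_dim[OF A.T1] card_subspace_eq_power_dim[OF B.T1] A.card_T1 B.card_T1 by simp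
  then have "V.dim T1 = V.dim S1"
    using card_subfield_ge_2[OF subfield_set_UNIV, where 'a='a] by simp
  then obtain k where k: "Vector_Spaces.linear smul smul k" "k ` T1 = S1" "inj_on k T1"
    using FP.subspace_isomorphism[OF A.T1 B.T1] by blast
  have kadd: "k (x + y) = k x + k y" and kscale: "k (c *s x) = c *s k x" for x y c
    using k(1) by (simp_all add: Vector_Spaces.linear_iff)
  have kS: "k x \<in> S1" if "x \<in> T1" for x using k(2) that by blast
  let ?gi = "inv_into T1 g"
  have gi: "?gi y \<in> T1" "g (?gi y) = y" if "y \<in> T2" for y
    using that A.g_bij by (auto simp: bij_betw_def inv_into_into f_inv_into_f)
  have gig: "?gi (g x) = x" if "x \<in> T1" for x
    using that A.g_bij by (simp add: bij_betw_def inv_into_f_f)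
  have gi_add: "?gi (y + z) = ?gi y + ?gi z" if "y \<in> T2" "z \<in> T2" for y z
    using that gi gig A.g_add V.subspace_add[OF A.T1] by metis
  have gi_scale: "h (k (?gi (c *s y))) = c *s h (k (?gi y))" if y: "y \<in> T2" for c y
  proof -
    obtain d :: 'a where d: "d ^ (q ^ i) = c" using frob_surj by blast
    have "c *s y = g (d *s ?gi y)" using gi[OF y] d by (simp add: A.g_scale)
    then have "?gi (c *s y) = d *s ?gi y" using gig V.subspace_scale[OF A.T1] gi[OF y] by simp
    then show ?thesis using B.g_scale kS gi[OF y] d by (simp add: kscale)
  qed
  \<comment> \<open>The projection onto \<open>T1\<close> along \<open>T2\<close>.\<close>
  define p where "p v = (THE x. x \<in> T1 \<and> v - x \<in> T2)" for v
  have p: "p (x + y) = x" if "x \<in> T1" "y \<in> T2" for x y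
    unfolding p_def
  proof (rule the_equality)
    fix x' assume "x' \<in> T1 \<and> x + y - x' \<in> T2"
    then show "x' = x" using A.sum_unique(1)[of x x' y "x + y - x'"] that by simp
  qed (use that in simp)
  define \<phi> where "\<phi> v = k (p v) + h (k (?gi (v - p v)))" for v
  have \<phi>: "\<phi> (x + y) = k x + h (k (?gi y))" if "x \<in> T1" "y \<in> T2" for x y
    using p[OF that] by (simp add: \<phi>_def)
  have add: "\<phi> (u + v) = \<phi> u + \<phi> v" for u v
  proof -
    obtain x y where u: "x \<in> T1" "y \<in> T2" "u = x + y" using A.sum_exists by blast
    obtain x' y' where v: "x' \<in> T1" "y' \<in> T2" "v = x' + y'" using A.sum_exists by blast
    have "u + v = (x + x') + (y + y')" using u v by (simp add: algebra_simps)
    then have "\<phi> (u + v) = k (x + x') + h (k (?gi (y + y')))"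
      using \<phi> V.subspace_add[OF A.T1 u(1) v(1)] V.subspace_add[OF A.T2 u(2) v(2)] by simp
    also have "\<dots> = \<phi> u + \<phi> v"
      using u v \<phi> kS gi by (simp add: kadd gi_add B.g_add algebra_simps)
    finally show ?thesis .
  qed
  have scale: "\<phi> (c *s u) = c *s \<phi> u" for c u
  proof -
    obtain x y where u: "x \<in> T1" "y \<in> T2" "u = x + y" using A.sum_exists by blast
    then have "\<phi> (c *s u) = k (c *s x) + h (k (?gi (c *s y)))"
      using \<phi> V.subspace_scale[OF A.T1] V.subspace_scale[OF A.T2] by (simp add: V.scale_right_distrib)
    also have "\<dots> = c *s \<phi> u" using u \<phi> by (simp add: kscale gi_scale V.scale_right_distrib)
    finally show ?thesis .
  qed
  have "inj \<phi>"
  proof (rule injI)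
    fix u v assume eq: "\<phi> u = \<phi> v"
    obtain x y where u: "x \<in> T1" "y \<in> T2" "u = x + y" using A.sum_exists by blast
    obtain x' y' where v: "x' \<in> T1" "y' \<in> T2" "v = x' + y'" using A.sum_exists by blast
    have e: "k x + h (k (?gi y)) = k x' + h (k (?gi y'))" using eq u v \<phi> by simp
    note S = B.sum_unique[OF kS[OF u(1)] kS[OF v(1)] B.g_in[OF kS[OF gi(1)[OF u(2)]]] B.g_in[OF kS[OF gi(1)[OF v(2)]]] e]
    have "x = x'" using S(1) k(3) u v by (meson inj_onD)
    moreover have "k (?gi y) = k (?gi y')" using S(2) B.g_inj kS gi(1) u v by blast
    then have "?gi y = ?gi y'" using k(3) gi(1) u v by (meson inj_onD)
    then have "y = y'" using gi(2) u v by metis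
    ultimately show "u = v" using u v by simp
  qed
  then have bij: "bij \<phi>" by (simp add: bij_def finite_UNIV_inj_surj)
  have "\<phi> ` A.graph = B.graph"
  proof -
    have "\<phi> ` A.graph = (\<lambda>x. k x + h (k x)) ` T1"
      unfolding A.graph_def image_image using \<phi> A.g_in gig by (intro image_cong) auto
    also have "\<dots> = (\<lambda>x. x + h x) ` k ` T1" by (simp only: image_image)
    also have "\<dots> = B.graph" by (simp only: k(2) B.graph_def)
    finally show ?thesis .
  qed
  then show ?thesis
    using collineation_linear_image[OF add scale bij] A(2) B(2) by metis
qed

end

subsection \<open>Classification and the number of orbits\<close>

lemma card_supported:
  fixes I :: "'i::finite set"
  shows "card {v :: 'i \<Rightarrow> 'a::{finite,zero}. \<forall>j. j \<notin> I \<longrightarrow> v j = 0} = card (UNIV :: 'a set) ^ card I"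
proof -
  have "bij_betw (\<lambda>v. restrict v I) {v :: 'i \<Rightarrow> 'a. \<forall>j. j \<notin> I \<longrightarrow> v j = 0} (I \<rightarrow>\<^sub>E UNIV)"
    by (rule bij_betw_byWitness[where f'="\<lambda>w j. if j \<in> I then w j else 0"])
      (auto simp: fun_eq_iff PiE_def extensional_def)
  then show ?thesis by (simp add: bij_betw_same_card card_PiE)
qed

lemma card_quotient_kernel:
  assumes "\<And>x y. (x, y) \<in> r \<longleftrightarrow> x \<in> A \<and> y \<in> A \<and> f x = f y"
  shows "card (A // r) = card (f ` A)"
proof (rule bij_betw_same_card[symmetric])
  let ?k = "\<lambda>P. {y \<in> A. f y = P}"
  show "bij_betw ?k (f ` A) (A // r)"
  proof (rule bij_betw_imageI)
    show "inj_on ?k (f ` A)" by (rule inj_onI) blast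
    have "?k (f x) = r `` {x}" if "x \<in> A" for x using that assms by auto
    then show "?k ` f ` A = A // r" unfolding quotient_def image_image by auto
  qed
qed

lemma totatives_less:
  fixes t :: nat
  assumes "t \<ge> 2" "i \<in> totatives t"
  shows "i < t"
  using assms by (cases "i = t") (auto simp: totatives_def)

lemma totatives_minus:
  fixes t :: nat
  assumes "t \<ge> 2" "i \<in> totatives t"
  shows "t - i \<in> totatives t"
proof -
  note lt = totatives_less[OF assms]
  have "gcd (t - i) t = gcd i t"
    using lt by (metis gcd.commute gcd_diff2_nat less_imp_le)
  then show ?thesis using assms lt by (auto simp: totatives_def coprime_iff_gcd_eq_1)
qed

text \<open>The involution \<open>i \<mapsto> t - i\<close> has no fixed point:
  \<open>t = 2 * i\<close> with \<open>i\<close> coprime to \<open>t\<close> forces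
  \<open>i = 1\<close> and \<open>t = 2\<close>.\<close>

lemma card_totative_pairs:
  fixes t :: nat
  assumes "t \<ge> 3"
  shows "card ((\<lambda>i. {i, t - i}) ` totatives t) = totient t div 2"
proof -
  let ?C = "(\<lambda>i. {i, t - i}) ` totatives t"
  have lt: "i < t" if "i \<in> totatives t" for i
    using totatives_less that assms by simp
  have cop: "t - i \<in> totatives t" if "i \<in> totatives t" for i
    using totatives_minus that assms by simp
  have "2 * card ?C = card (\<Union>?C)"
  proof (rule card_partition)
    fix c assume "c \<in> ?C"
    then obtain i where i: "i \<in> totatives t" "c = {i, t - i}" by blast
    have "i \<noteq> t - i"
    proof
      assume "i = t - i"
      then have t: "t = 2 * i" using lt[OF i(1)] by simp
      then have "coprime i (2 * i)" using i(1) by (simp add: totatives_def)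
      then have "i = 1" by simp
      then show False using t assms by simp
    qed
    then show "card c = 2" using i by simp
  next
    fix c d assume "c \<in> ?C" "d \<in> ?C" "c \<noteq> d"
    then show "c \<inter> d = {}" using lt by (auto simp: doubleton_eq_iff) (metis diff_diff_cancel less_imp_le)+
  qed auto
  also have "\<Union>?C = totatives t" using cop by blast
  finally show ?thesis by (simp add: totient_def)
qed

context ambient begin

text \<open>A model in coordinates: the two spaces are supported on complementary halves of the
  index set, and \<open>g\<close> moves coordinates from one half to the other while raising them to
  the power \<open>q ^ i\<close>.\<close>

lemma has_type_exists:
  assumes "coprime i t"
  shows "\<exists>L. has_type i L"
proof -
  obtain I :: "'i set" where I: "card I = n"
    using obtain_subset_with_card_n[of n "UNIV :: 'i set"] card_index by auto
  then have "card (- I) = n" by (simp add: Compl_eq_Diff_UNIV card_Diff_subset card_index)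
  then obtain \<pi> where \<pi>: "bij_betw \<pi> (- I) I" using I finite_same_card_bij[of "- I" I] by auto
  define T1 where "T1 = {v :: 'i \<Rightarrow> 'a. \<forall>j. j \<notin> I \<longrightarrow> v j = 0}"
  define T2 where "T2 = {v :: 'i \<Rightarrow> 'a. \<forall>j. j \<notin> - I \<longrightarrow> v j = 0}"
  define g where "g v = (\<lambda>j. if j \<in> I then 0 else v (\<pi> j) ^ (q ^ i))" for v :: "'i \<Rightarrow> 'a"
  have "semilinear_graph q t n i T1 T2 g"
  proof unfold_locales
    show "V.subspace T1" "V.subspace T2" by (auto simp: T1_def T2_def V.subspace_def)
    show "card T1 = q ^ (t * n)" "card T2 = q ^ (t * n)"
      unfolding T1_def T2_def card_supported by (simp_all add: card_field I \<open>card (- I) = n\<close> power_mult)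
    show "T1 \<inter> T2 = {0}" by (auto simp: T1_def T2_def fun_eq_iff) metis
    show add: "g (x + y) = g x + g y" for x y by (auto simp: g_def fun_eq_iff frob_add)
    show "g (c *s x) = c ^ q ^ i *s g x" for c x by (auto simp: g_def fun_eq_iff power_mult_distrib)
    show "bij_betw g T1 T2"
    proof (rule bij_betw_imageI)
      show inj: "inj_on g T1"
      proof (rule inj_onI, rule ext)
        fix v w j assume v: "v \<in> T1" and w: "w \<in> T1" and eq: "g v = g w"
        show "v j = w j"
        proof (cases "j \<in> I")
          case True
          then obtain k where k: "k \<notin> I" "j = \<pi> k" using \<pi> by (auto simp: bij_betw_def)
          then have "v j ^ (q ^ i) = w j ^ (q ^ i)" using fun_cong[OF eq, of k] by (simp add: g_def)
          then show ?thesis by (rule frob_inj)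
        next
          case False
          then show ?thesis using v w by (simp add: T1_def)
        qed
      qed
      have "card T1 = card T2"
        unfolding T1_def T2_def card_supported by (simp add: I \<open>card (- I) = n\<close>)
      moreover have "g ` T1 \<subseteq> T2" by (auto simp: g_def T2_def)
      ultimately show "g ` T1 = T2" using inj by (intro card_subset_eq) (auto simp: card_image)
    qed
  qed (rule assms)
  then show ?thesis unfolding has_type_def by blast
qed

text \<open>With \<open>w = |T1 \<inter> T2|\<close> and \<open>N = q^{tn}\<close>: all but \<open>w - 1\<close> vectors of \<open>U\<close> lie in \<open>T1 + T2\<close>, while
  \<open>U \<inter> T1 = 0\<close> leaves room for at most \<open>N / w\<close> of them, so \<open>(w - 1) (N - w) \<le> 0\<close>.\<close>
lemma transversals_disjoint:
  fixes U T1 T2 :: "('i \<Rightarrow> 'a) set"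
  assumes T: "T1 \<in> transversals S" "T2 \<in> transversals S" and neq: "T1 \<noteq> T2"
    and S_sub: "\<And>s. s \<in> S \<Longrightarrow> V.subspace s" and S_card: "\<And>s. s \<in> S \<Longrightarrow> card s = (q ^ t) ^ 2"
    and S_disj: "\<And>s s'. s \<in> S \<Longrightarrow> s' \<in> S \<Longrightarrow> s \<noteq> s' \<Longrightarrow> s \<inter> s' = {0}"
    and S_U: "\<And>s. s \<in> S \<Longrightarrow> card (s \<inter> U) = q ^ t" and card_U: "card U = q ^ (t * n)"
    and U0: "0 \<in> U" and U_diff: "\<And>u v. u \<in> U \<Longrightarrow> v \<in> U \<Longrightarrow> u - v \<in> U"
    and U_covered: "U - {0} \<subseteq> \<Union>S" and U_T: "\<And>u. u \<in> U \<Longrightarrow> u \<in> T1 \<Longrightarrow> u = 0"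
  shows "T1 \<inter> T2 = {0}"
proof -
  have T1: "V.subspace T1" and T2: "V.subspace T2"
    and card_T1: "card T1 = q ^ (t * n)" and card_T2: "card T2 = q ^ (t * n)"
    and S_T1: "\<And>s. s \<in> S \<Longrightarrow> s \<inter> T1 \<noteq> {0}" and S_T2: "\<And>s. s \<in> S \<Longrightarrow> s \<inter> T2 \<noteq> {0}"
    using T by (auto simp: transversals_def)
  note sc1 = V.subspace_scale[OF T1] and sc2 = V.subspace_scale[OF T2]
    and ad1 = V.subspace_add[OF T1] and df1 = V.subspace_diff[OF T1] and df2 = V.subspace_diff[OF T2]
  define W where "W = T1 \<inter> T2"
  have W: "V.subspace W" unfolding W_def using T1 T2 by (rule V.subspace_inter)
  define M where "M = {x + y | x y. x \<in> T1 \<and> y \<in> T2}"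
  define A where "A = {s \<in> S. s \<inter> W \<noteq> {0}}"
  \<comment> \<open>A line without nonzero vectors of \<open>W\<close> meets \<open>T1\<close> and
    \<open>T2\<close> in different points, so it is spanned by them.\<close>
  have in_M: "s \<subseteq> M" if s: "s \<in> S" "s \<notin> A" for s
  proof -
    obtain p where p: "p \<in> s" "p \<in> T1" "p \<noteq> 0"
      using S_T1[OF s(1)] V.subspace_0[OF S_sub[OF s(1)]] V.subspace_0[OF T1] by blast
    obtain r where r: "r \<in> s" "r \<in> T2" "r \<noteq> 0"
      using S_T2[OF s(1)] V.subspace_0[OF S_sub[OF s(1)]] V.subspace_0[OF T2] by blast
    have "r \<notin> V.span {p}"
    proof
      assume "r \<in> V.span {p}"
      then have "r \<in> T1" using V.span_minimal[of "{p}" T1] T1 p by blast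
      then have "r \<in> s \<inter> W" using r by (simp add: W_def)
      then show False using s r by (auto simp: A_def)
    qed
    then have "s = V.span {p, r}"
      using subspace_line_eq[OF S_sub[OF s(1)] _ p(1) r(1) p(3)] S_card[OF s(1)] by (simp add: card_field)
    then show ?thesis
      using sc1[OF p(2)] sc2[OF r(2)] by (simp add: in_span_pair subset_iff M_def) blast
  qed
  \<comment> \<open>A line in \<open>A\<close> holds \<open>q ^ t - 1\<close> nonzero vectors of
    \<open>U\<close> and at least as many of \<open>W\<close>; as lines are disjoint,
    \<open>W\<close> bounds the total.\<close>
  have "card (U - M) \<le> card W - 1"
  proof -
    have "U - M \<subseteq> (\<Union>s\<in>A. s \<inter> U - {0})"
    proof
      fix u assume u: "u \<in> U - M"
      have "0 + 0 \<in> M" using V.subspace_0[OF T1] V.subspace_0[OF T2] unfolding M_def by blast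
      then have "u \<noteq> 0" using u by auto
      then obtain s where "s \<in> S" "u \<in> s" using u U_covered by blast
      then show "u \<in> (\<Union>s\<in>A. s \<inter> U - {0})" using in_M u \<open>u \<noteq> 0\<close> by blast
    qed
    then have "card (U - M) \<le> card (\<Union>s\<in>A. s \<inter> U - {0})" by (intro card_mono) auto
    also have "\<dots> \<le> (\<Sum>s\<in>A. card (s \<inter> U - {0}))" by (rule card_UN_le) simp
    also have "\<dots> \<le> (\<Sum>s\<in>A. card (s \<inter> W - {0}))"
    proof (rule sum_mono)
      fix s assume "s \<in> A"
      then have s: "s \<in> S" "s \<inter> W \<noteq> {0}" by (simp_all add: A_def)
      have "card (s \<inter> U - {0}) = q ^ t - 1"
        using S_U[OF s(1)] U0 V.subspace_0[OF S_sub[OF s(1)]] by (simp add: card_Diff_singleton)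
      then show "card (s \<inter> U - {0}) \<le> card (s \<inter> W - {0})"
        using card_subspace_ge[OF s(2) V.subspace_inter[OF S_sub[OF s(1)] W]] by simp
    qed
    also have "\<dots> = card (\<Union>s\<in>A. s \<inter> W - {0})"
      using S_disj by (intro card_UN_disjoint[symmetric]) (auto simp: A_def)
    also have "\<dots> \<le> card (W - {0})" by (intro card_mono) auto
    also have "\<dots> = card W - 1" using V.subspace_0[OF W] by (simp add: card_Diff_singleton)
    finally show ?thesis .
  qed
  moreover have "card (U \<inter> M) * card W \<le> q ^ (t * n)"
  proof -
    have "\<exists>x y. x \<in> T1 \<and> y \<in> T2 \<and> u = x + y" if "u \<in> M" for u using that by (auto simp: M_def)
    then obtain a b where ab: "\<And>u. u \<in> M \<Longrightarrow> a u \<in> T1 \<and> b u \<in> T2 \<and> u = a u + b u" by metis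
    \<comment> \<open>The sums \<open>u + x\<close> are distinct vectors of \<open>M\<close>,
      because \<open>U\<close> meets \<open>T1\<close> trivially; the shifts by \<open>z\<close> run
      through the \<open>card W\<close> ways of splitting each of them.\<close>
    let ?f = "\<lambda>(u, x, z). (a u + x + z, b u - z)"
    have "?f ` ((U \<inter> M) \<times> T1 \<times> W) \<subseteq> T1 \<times> T2"
      using ab ad1 df2 by (auto simp: W_def)
    then have "card (?f ` ((U \<inter> M) \<times> T1 \<times> W)) \<le> card (T1 \<times> T2)" by (intro card_mono) auto
    moreover have "inj_on ?f ((U \<inter> M) \<times> T1 \<times> W)"
    proof (rule inj_onI)
      fix v v' assume v: "v \<in> (U \<inter> M) \<times> T1 \<times> W" "v' \<in> (U \<inter> M) \<times> T1 \<times> W" "?f v = ?f v'"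
      obtain u x z u' x' z' where eq: "v = (u, x, z)" "v' = (u', x', z')" by (metis prod_cases3)
      have m: "u \<in> U" "u \<in> M" "x \<in> T1" "z \<in> W" "u' \<in> U" "u' \<in> M" "x' \<in> T1" "z' \<in> W"
        and e: "a u + x + z = a u' + x' + z'" "b u - z = b u' - z'"
        using v by (auto simp: eq)
      have "u + x = (a u + x + z) + (b u - z)" "u' + x' = (a u' + x' + z') + (b u' - z')"
        using ab[OF m(2)] ab[OF m(6)] by (simp_all add: algebra_simps)
      then have "u + x = u' + x'" using e by simp
      then have "u - u' = x' - x" by (simp add: algebra_simps)
      then have "u - u' \<in> T1" using df1 m by simp
      then have "u - u' = 0" using U_T U_diff m by blast
      then show "v = v'" using \<open>u + x = u' + x'\<close> e by (simp add: eq)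
    qed
    ultimately have "card (U \<inter> M) * (card T1 * card W) \<le> card T1 * card T2"
      by (simp add: card_image card_cartesian_product)
    then have "card T1 * (card (U \<inter> M) * card W) \<le> card T1 * card T2" by (simp add: algebra_simps)
    moreover have "card T1 > 0" using card_T1 q_ge_2 by simp
    ultimately show ?thesis using card_T2 by simp
  qed
  moreover have "card U = card (U \<inter> M) + card (U - M)"
    by (metis card_Int_Diff finite)
  ultimately have "q ^ (t * n) - (card W - 1) \<le> card (U \<inter> M)" "card (U \<inter> M) * card W \<le> q ^ (t * n)"
    using card_U by linarith+
  then have "(q ^ (t * n) - (card W - 1)) * card W \<le> q ^ (t * n)"
    by (meson le_trans mult_le_mono1)
  moreover have "card W \<le> q ^ (t * n)" unfolding card_T1[symmetric] W_def by (intro card_mono) auto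
  moreover have "card W \<noteq> q ^ (t * n)"
  proof
    assume "card W = q ^ (t * n)"
    then have "W = T1" "W = T2" using card_T1 card_T2 card_subset_eq[of T1 W] card_subset_eq[of T2 W]
      by (auto simp: W_def)
    then show False using neq by simp
  qed
  moreover have "card W > 0" using V.subspace_0[OF W] by (auto simp: card_gt_0_iff)
  ultimately have "card W = 1"
  proof -
    \<comment> \<open>Here \<open>w\<close> is one less than \<open>card W\<close>, and
      \<open>d > 0\<close> is what \<open>W\<close> lacks in size; the inequality reduces to
      \<open>d * w \<le> 0\<close>.\<close>
    obtain w where w: "card W = Suc w" using \<open>card W > 0\<close> by (cases "card W") auto
    define d where "d = q ^ (t * n) - card W"
    have N: "q ^ (t * n) = Suc w + d" and d: "d > 0"
      using \<open>card W \<le> q ^ (t * n)\<close> \<open>card W \<noteq> q ^ (t * n)\<close> w by (auto simp: d_def)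
    have "(Suc d) * Suc w \<le> Suc w + d"
      using \<open>(q ^ (t * n) - (card W - 1)) * card W \<le> q ^ (t * n)\<close> unfolding N w by simp
    then have "d * w \<le> 0" by simp
    then show ?thesis using d w by simp
  qed
  then obtain z where "W = {z}" by (auto simp: card_1_singleton_iff)
  then show ?thesis using V.subspace_0[OF W] by (simp add: W_def)
qed

lemma pseudoregulus_type_imp_has_type:
  assumes "pseudoregulus_type q t n L"
  shows "\<exists>i\<in>totatives t. has_type i L"
proof -
  obtain U S where U: "subsp (subfieldq q) U" and L: "L = linset U" and scat: "scattered q U"
    and dimU: "dimK (subfieldq q) U = t * n"
    and card_S': "card S = (q ^ (n * t) - 1) div (q ^ t - 1)"
    and S_lines': "\<forall>s\<in>S. proj_line s \<and> weight q U s = t"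
    and S_disj': "\<forall>s\<in>S. \<forall>s'\<in>S. s \<noteq> s' \<longrightarrow> s \<inter> s' = {vzero}"
    and card_T: "card {T. subsp UNIV T \<and> dimK UNIV T = n \<and> (\<forall>P\<in>L. \<not> P \<subseteq> T) \<and> (\<forall>s\<in>S. s \<inter> T \<noteq> {vzero})} = 2"
    using assms unfolding pseudoregulus_type_def by (elim exE conjE) (rule that)
  have S_lines: "proj_line s \<and> weight q U s = t" if "s \<in> S" for s
    using S_lines' that by blast
  have S_disj: "s \<inter> s' = {0}" if "s \<in> S" "s' \<in> S" "s \<noteq> s'" for s s'
    using S_disj' that by (simp add: vzero_eq_0)
  have card_U: "card U = q ^ (t * n)" using dimU U by (simp add: dimK_subfieldq_eq_iff)
  have S_sub: "V.subspace s" if "s \<in> S" for s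
    using S_lines[OF that] by (simp add: proj_line_def subsp_UNIV_eq)
  have S_card: "card s = (q ^ t) ^ 2" if "s \<in> S" for s
    using S_lines[OF that] S_sub[OF that] dimK_UNIV_eq_iff[of s 2] by (simp add: proj_line_def)
  have S_U: "card (s \<inter> U) = q ^ t" if s: "s \<in> S" for s
    using S_lines[OF s] subsp_Int[OF subsp_of_subspace[OF S_sub[OF s]] U]
    by (simp add: weight_def dimK_subfieldq_eq_iff)
  have q_pos: "q ^ t - 1 > 0" using q_less_q_pow_t q_ge_2 by simp
  have card_S: "card S * (q ^ t - 1) = q ^ (t * n) - 1"
  proof -
    have "int (q ^ t) - 1 dvd int (q ^ t) ^ n - 1"
      by (metis dvd_triv_left power_diff_1_eq)
    then have "int (q ^ t - 1) dvd int (q ^ (t * n) - 1)"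
      using q_ge_2 by (simp add: power_mult of_nat_diff)
    then have "(q ^ t - 1) dvd (q ^ (t * n) - 1)" by (simp only: int_dvd_int_iff)
    then show ?thesis by (simp add: card_S' mult.commute)
  qed
  have U0: "0 \<in> U" using U by (simp add: subsp_iff)
  have U_covered: "U - {0} \<subseteq> \<Union>S"
  proof (rule covered_by_counting[where k="q ^ t - 1"])
    show "q ^ t - 1 \<le> card (s \<inter> U - {0})" if s: "s \<in> S" for s
      using S_U[OF s] U0 V.subspace_0[OF S_sub[OF s]] by (simp add: card_Diff_singleton)
    show "card U \<le> card S * (q ^ t - 1) + 1" using card_S card_U by linarith
  qed (use S_disj U0 in auto)
  obtain T1 T2 where neq: "T1 \<noteq> T2"
    and T_eq: "{T. subsp UNIV T \<and> dimK UNIV T = n \<and> (\<forall>P\<in>L. \<not> P \<subseteq> T) \<and> (\<forall>s\<in>S. s \<inter> T \<noteq> {vzero})} = {T1, T2}"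
    using card_T unfolding card_2_iff by metis
  have T_prop: "V.subspace T \<and> card T = q ^ (t * n) \<and> (\<forall>P\<in>L. \<not> P \<subseteq> T) \<and> (\<forall>s\<in>S. s \<inter> T \<noteq> {0})"
    if "T \<in> {T1, T2}" for T
    using that unfolding T_eq[symmetric] subsp_UNIV_eq vzero_eq_0
    using dimK_UNIV_eq_iff[of T n] by (simp add: power_mult)
  have T1: "V.subspace T1" and T2: "V.subspace T2"
    and card_T1: "card T1 = q ^ (t * n)" and card_T2: "card T2 = q ^ (t * n)"
    and S_T1: "\<And>s. s \<in> S \<Longrightarrow> s \<inter> T1 \<noteq> {0}" and S_T2: "\<And>s. s \<in> S \<Longrightarrow> s \<inter> T2 \<noteq> {0}"
    using T_prop[of T1] T_prop[of T2] by auto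
  have U_T: "u = 0" if u: "u \<in> U" "u \<in> T" "T \<in> {T1, T2}" for u T
  proof (rule ccontr)
    assume "u \<noteq> 0"
    then have "V.span {u} \<in> L" using u by (auto simp: L linset_eq)
    moreover have "V.span {u} \<subseteq> T" using T_prop[OF u(3)] u(2) by (intro V.span_minimal) auto
    ultimately show False using T_prop[OF u(3)] by blast
  qed
  have U_add: "u + v \<in> U" if "u \<in> U" "v \<in> U" for u v using U that by (simp add: subsp_iff)
  have U_diff: "u - v \<in> U" if "u \<in> U" "v \<in> U" for u v
  proof -
    have "- 1 \<in> (subfieldq q :: 'a set)" using subfield_subfieldq by (simp add: subfield_set_def)
    then have "(- 1) *s v \<in> U" using U that unfolding subsp_iff by blast
    moreover have "(- 1) *s v = - v" by (simp add: fun_eq_iff)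
    ultimately show ?thesis using U_add[OF that(1), of "- v"] by simp
  qed
  note sc1 = V.subspace_scale[OF T1] and sc2 = V.subspace_scale[OF T2]
    and ad1 = V.subspace_add[OF T1] and ad2 = V.subspace_add[OF T2]
    and df1 = V.subspace_diff[OF T1] and df2 = V.subspace_diff[OF T2]
  have disjoint: "T1 \<inter> T2 = {0}"
    using T1 T2 card_T1 card_T2 S_T1 S_T2 U_T
    by (intro transversals_disjoint[OF _ _ neq S_sub S_card S_disj S_U card_U U0 U_diff U_covered])
      (auto simp: transversals_def)
  note sum_unique = direct_sum_unique[OF T1 T2 disjoint]
    and sum_exists = direct_sum_exists[OF T1 T2 disjoint card_T1 card_T2]
  define p where "p v = (SOME x. x \<in> T1 \<and> v - x \<in> T2)" for v
  have p: "p v \<in> T1" "v - p v \<in> T2" for v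
  proof -
    have "\<exists>x. x \<in> T1 \<and> v - x \<in> T2" using sum_exists[of v] by (metis add_diff_cancel_left')
    then show "p v \<in> T1" "v - p v \<in> T2" unfolding p_def by (metis (mono_tags, lifting) someI_ex)+
  qed
  \<comment> \<open>\<open>U\<close> misses \<open>T2\<close>, so the projection along
    \<open>T2\<close> is injective on \<open>U\<close>; by equal sizes it reaches all of
    \<open>T1\<close>.\<close>
  have "inj_on p U"
  proof (rule inj_onI)
    fix u v assume uv: "u \<in> U" "v \<in> U" "p u = p v"
    have "u - v = (u - p u) - (v - p v)" using uv(3) by simp
    then have "u - v \<in> T2" using df2 p by metis
    then show "u = v" using U_T U_diff uv by (metis eq_iff_diff_eq_0 insertCI)
  qed
  then have "card (p ` U) = card T1" by (simp add: card_image card_U card_T1)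
  moreover have "p ` U \<subseteq> T1" using p by blast
  ultimately have pU: "p ` U = T1" by (intro card_subset_eq) auto
  have "\<exists>y. x \<in> T1 \<longrightarrow> y \<in> T2 \<and> x + y \<in> U" for x
  proof (cases "x \<in> T1")
    case True
    then obtain u where "u \<in> U" "x = p u" using pU by blast
    then show ?thesis using p(2)[of u] by (intro exI[of _ "u - x"]) simp
  qed simp
  then obtain g where g: "\<And>x. x \<in> T1 \<Longrightarrow> g x \<in> T2" "\<And>x. x \<in> T1 \<Longrightarrow> x + g x \<in> U" by metis
  have g_unique: "y = g x" if xy: "x \<in> T1" "y \<in> T2" "x + y \<in> U" for x y
  proof -
    have "y - g x = (x + y) - (x + g x)" by simp
    then have "y - g x \<in> U" using U_diff[OF xy(3) g(2)[OF xy(1)]] by simp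
    moreover have "y - g x \<in> T2" using df2 g xy by simp
    ultimately have "y - g x = 0" using U_T by blast
    then show ?thesis by simp
  qed
  have g_inj: "inj_on g T1"
  proof (rule inj_onI)
    fix x y assume xy: "x \<in> T1" "y \<in> T1" "g x = g y"
    have "x - y = (x + g x) - (y + g y)" using xy(3) by simp
    then have "x - y \<in> U" using U_diff[OF g(2)[OF xy(1)] g(2)[OF xy(2)]] by simp
    moreover have "x - y \<in> T1" using df1 xy by simp
    ultimately have "x - y = 0" using U_T by blast
    then show "x = y" by simp
  qed
  have g_bij: "bij_betw g T1 T2"
    using g_inj g(1) card_T1 card_T2 unfolding bij_betw_def
    by (intro conjI card_subset_eq) (auto simp: card_image)
  have g_add: "g (x + y) = g x + g y" if xy: "x \<in> T1" "y \<in> T1" for x y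
  proof (rule g_unique[symmetric])
    have "(x + y) + (g x + g y) = (x + g x) + (y + g y)" by (simp add: algebra_simps)
    then show "(x + y) + (g x + g y) \<in> U" using U_add[OF g(2)[OF xy(1)] g(2)[OF xy(2)]] by metis
  qed (use ad1 ad2 g xy in auto)
  have z1: "0 \<in> T1" and z2: "0 \<in> T2" using V.subspace_0 T1 T2 by blast+
  have g0: "g 0 = 0" using g_unique[OF z1 z2] U0 by simp
  have g_nz: "g x \<noteq> 0" if "x \<in> T1" "x \<noteq> 0" for x
    using g_inj that z1 g0 by (metis inj_onD)
  have graph: "U = (\<lambda>x. x + g x) ` T1"
  proof (rule sym, rule card_subset_eq)
    have "inj_on (\<lambda>x. x + g x) T1" using sum_unique g(1) by (meson inj_onI)
    then show "card ((\<lambda>x. x + g x) ` T1) = card U" by (simp add: card_image card_T1 card_U)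
  qed (use g(2) in auto)
  \<comment> \<open>The line of \<open>S\<close> through \<open>x + g x\<close> is spanned by a
    vector of \<open>T1\<close> and one of \<open>T2\<close>; comparing components puts
    \<open>x\<close> and \<open>g x\<close> on it.\<close>
  have line: "V.span {x, g x} \<in> S" if x: "x \<in> T1" "x \<noteq> 0" for x
  proof -
    have "x + g x \<noteq> 0 + 0" using sum_unique[OF x(1) z1 g(1)[OF x(1)] z2] x(2) by blast
    then obtain s where s: "s \<in> S" "x + g x \<in> s" using U_covered g(2)[OF x(1)] by auto
    obtain a where a: "a \<in> s" "a \<in> T1" "a \<noteq> 0"
      using S_T1[OF s(1)] V.subspace_0[OF S_sub[OF s(1)]] z1 by blast
    obtain b where b: "b \<in> s" "b \<in> T2" "b \<noteq> 0"
      using S_T2[OF s(1)] V.subspace_0[OF S_sub[OF s(1)]] z2 by blast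
    have "b \<notin> V.span {a}"
    proof
      assume "b \<in> V.span {a}"
      then have "b \<in> T1" using V.span_minimal[of "{a}" T1] T1 a by blast
      then show False using disjoint b by blast
    qed
    then have s_eq: "s = V.span {a, b}"
      using subspace_line_eq[OF S_sub[OF s(1)] _ a(1) b(1) a(3)] S_card[OF s(1)] by (simp add: card_field)
    then obtain k l where "x + g x = k *s a + l *s b" using s(2) by (auto simp: in_span_pair)
    then have "x = k *s a" "g x = l *s b"
      using sum_unique[OF x(1) sc1[OF a(2), of k] g(1)[OF x(1)] sc2[OF b(2), of l]] by blast+
    then have xs: "x \<in> s" "g x \<in> s" using V.subspace_scale[OF S_sub[OF s(1)]] a b by auto
    have "g x \<notin> V.span {x}"
    proof
      assume "g x \<in> V.span {x}"
      then have "g x \<in> T1" using V.span_minimal[of "{x}" T1] T1 x by blast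
      then show False using disjoint g(1) g_nz x by blast
    qed
    then have "s = V.span {x, g x}"
      using subspace_line_eq[OF S_sub[OF s(1)] _ xs x(2)] S_card[OF s(1)] by (simp add: card_field)
    then show ?thesis using s by simp
  qed
  \<comment> \<open>Disjointness of the lines in \<open>S\<close> is what makes \<open>g\<close>
    respect points, in both directions.\<close>
  have line_span: "g y \<in> V.span {g x} \<and> y \<in> V.span {x}"
    if x: "x \<in> T1" "x \<noteq> 0" and y: "y \<in> T1" "y \<noteq> 0" and z: "z \<in> V.span {x, g x}" "z \<in> V.span {y, g y}" "z \<noteq> 0" for x y z
  proof -
    have "V.span {x, g x} = V.span {y, g y}" using S_disj[OF line[OF x] line[OF y]] z by blast
    then have "y + g y \<in> V.span {x, g x}" by (simp add: V.span_add V.span_base)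
    then obtain a b where "y + g y = a *s x + b *s g x" by (auto simp: in_span_pair)
    then have "y = a *s x" "g y = b *s g x"
      using sum_unique[OF y(1) sc1[OF x(1)] g(1)[OF y(1)] sc2[OF g(1)[OF x(1)]]] by blast+
    then show ?thesis using in_span_singleton by blast
  qed
  have pt: "g (c *s x) \<in> V.span {g x}" if x: "x \<in> T1" for c x
  proof (cases "c = 0 \<or> x = 0")
    case True
    then show ?thesis using g0 by (auto simp: V.span_zero)
  next
    case False
    then have cx: "c *s x \<in> T1" "c *s x \<noteq> 0" and x0: "x \<noteq> 0" using sc1 x by auto
    have "c *s x \<in> V.span {x, g x}" by (intro V.span_scale V.span_base) simp
    moreover have "c *s x \<in> V.span {c *s x, g (c *s x)}" by (intro V.span_base) simp
    ultimately show ?thesis using line_span[OF x x0 cx] cx(2) by blast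
  qed
  have indep: "g y \<notin> V.span {g x}" if xy: "x \<in> T1" "y \<in> T1" "x \<noteq> 0" "y \<notin> V.span {x}" for x y
  proof
    assume gy: "g y \<in> V.span {g x}"
    have y0: "y \<noteq> 0" using xy V.span_zero by metis
    have "g y \<in> V.span {x, g x}" using gy V.span_mono[of "{g x}" "{x, g x}"] by blast
    moreover have "g y \<in> V.span {y, g y}" by (intro V.span_base) simp
    ultimately show False using line_span[OF xy(1,3,2) y0] g_nz[OF xy(2) y0] xy(4) by blast
  qed
  note out = exists_outside_span[OF card_T1]
  obtain x0 where x0: "x0 \<in> T1" "x0 \<noteq> 0" using out[of 0] by auto
  obtain y0 where y0: "y0 \<in> T1" "y0 \<notin> V.span {x0}" using out by blast
  have "\<exists>s. (\<forall>c. \<forall>x\<in>T1. g (c *s x) = s c *s g x) \<and>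
    (\<forall>c d. s (c + d) = s c + s d) \<and> (\<forall>c d. s (c * d) = s c * s d) \<and> s 1 = 1"
    by (rule additive_point_map_semilinear[OF T1 g_add pt g_nz indep x0(1) y0(1) x0(2) y0(2)]) assumption+
  then obtain s where s: "\<And>c x. x \<in> T1 \<Longrightarrow> g (c *s x) = s c *s g x"
    "\<And>c d. s (c + d) = s c + s d" "\<And>c d. s (c * d) = s c * s d" "s 1 = 1"
    by blast
  let ?u = "x0 + g x0"
  have u: "?u \<in> U" "?u \<noteq> 0"
    using g(2) x0 sum_unique[OF x0(1) z1 g(1)[OF x0(1)] z2] by auto
  have s_iff: "s c = c \<longleftrightarrow> c *s ?u \<in> U" for c
  proof
    assume "s c = c"
    then have "c *s ?u = c *s x0 + g (c *s x0)" using s x0 by (simp add: V.scale_right_distrib)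
    then show "c *s ?u \<in> U" using g(2) sc1 x0 by simp
  next
    assume "c *s ?u \<in> U"
    then have "c *s g x0 = g (c *s x0)"
      using sc1 sc2 g(1) x0 by (intro g_unique) (auto simp: V.scale_right_distrib)
    then have "c *s g x0 = s c *s g x0" using s x0 by simp
    then show "s c = c" using g_nz x0 by simp
  qed
  \<comment> \<open>One inclusion is closure of \<open>U\<close> under scalars; scatteredness gives
    the larger set only \<open>q\<close> elements.\<close>
  have "{c. c *s ?u \<in> U} = subfieldq q"
  proof (rule sym, rule card_subset_eq)
    show "subfieldq q \<subseteq> {c. c *s ?u \<in> U}" using U u unfolding subsp_iff by blast
    have "V.span {?u} \<in> linset U" using u by (auto simp: linset_eq)
    then have "dimK (subfieldq q) (V.span {?u} \<inter> U) = 1" using scat by (simp add: scattered_def weight_def)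
    then have "card (V.span {?u} \<inter> U) = q"
      using dimK_subfieldq_eq_iff[OF subsp_Int[OF subsp_of_subspace[OF V.subspace_span] U], of "{?u}" 1] by simp
    moreover have "V.span {?u} \<inter> U = (\<lambda>c. c *s ?u) ` {c. c *s ?u \<in> U}"
      unfolding V.span_singleton by blast
    moreover have "inj (\<lambda>c. c *s ?u)" using u(2) by (auto intro!: injI)
    ultimately show "card (subfieldq q :: 'a set) = card {c. c *s ?u \<in> U}"
      by (simp add: card_image inj_on_subset card_subfieldq)
  qed simp
  then have "s c = c \<longleftrightarrow> c \<in> subfieldq q" for c using s_iff by blast
  then obtain i where i: "i \<in> totatives t" "\<And>x. s x = x ^ (q ^ i)"
    using automorphism_is_frob[OF s(2,3,4)] by metis
  have sg: "semilinear_graph q t n i T1 T2 g"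
  proof unfold_locales
    show "coprime i t" using i by (simp add: totatives_def)
    show "g (c *s x) = c ^ q ^ i *s g x" if "x \<in> T1" for c x using s(1)[OF that] i(2) by simp
  qed (fact T1 T2 card_T1 card_T2 disjoint g_bij g_add | assumption)+
  moreover have "L = linset (semilinear_graph.graph T1 g)"
    using L graph semilinear_graph.graph_def[OF sg] by simp
  ultimately show ?thesis using i(1) unfolding has_type_def by blast
qed

end

theorem theorem3p13:
  fixes q t n :: nat
  assumes "\<exists>p e. prime p \<and> e > 0 \<and> q = p ^ e"
    and "card (UNIV :: 'a::{finite,field} set) = q ^ t"
    and "card (UNIV :: 'i::finite set) = 2 * n"
    and "n \<ge> 2" and "t \<ge> 3"
  shows "card ({L :: ('i \<Rightarrow> 'a) set set. pseudoregulus_type q t n L}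
                // coll_equiv {L. pseudoregulus_type q t n L}) = totient t div 2"
proof -
  interpret ambient q t "TYPE('a)" n "TYPE('i)"
    using assms by unfold_locales
  define A where "A = {L :: ('i \<Rightarrow> 'a) set set. pseudoregulus_type q t n L}"
  \<comment> \<open>Collecting all exponents makes the invariant independent of the graph chosen for
    \<open>L\<close>; orbits are the fibres of this map.\<close>
  define types where "types L = {i \<in> totatives t. has_type i L}" for L
  have lt: "i < t" if "i \<in> totatives t" for i
    using totatives_less that t_ge_3 by simp
  have swap: "t - i \<in> totatives t" if "i \<in> totatives t" for i
    using totatives_minus that t_ge_3 by simp
  have types: "types L = {i, t - i}" if i: "i \<in> totatives t" "has_type i L" for i L
    using has_type_unique[OF i(2)] has_type_swap[OF i(2) lt[OF i(1)]] lt i swap[OF i(1)]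
    by (auto simp: types_def)
  have A_type: "\<exists>i\<in>totatives t. has_type i L" if "L \<in> A" for L
    using pseudoregulus_type_imp_has_type that by (simp add: A_def)
  have "(L, L') \<in> coll_equiv A \<longleftrightarrow> L \<in> A \<and> L' \<in> A \<and> types L = types L'" for L L'
  proof -
    have "(\<exists>f. collineation f \<and> f ` L = L') \<longleftrightarrow> types L = types L'" if L: "L \<in> A" "L' \<in> A"
    proof
      obtain i where i: "i \<in> totatives t" "has_type i L" using A_type[OF L(1)] by blast
      {
        assume "\<exists>f. collineation f \<and> f ` L = L'"
        then have "has_type i L'" using has_type_collineation[OF i(2)] by blast
        then show "types L = types L'" using types i by simp
      next
        assume "types L = types L'"
        then have "has_type i L'" using i by (auto simp: types_def)
        then show "\<exists>f. collineation f \<and> f ` L = L'" using has_type_equivalent i(2) by blast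
      }
    qed
    then show ?thesis unfolding coll_equiv_def by auto
  qed
  then have "card (A // coll_equiv A) = card (types ` A)" by (rule card_quotient_kernel)
  also have "types ` A = (\<lambda>i. {i, t - i}) ` totatives t"
  proof
    show "types ` A \<subseteq> (\<lambda>i. {i, t - i}) ` totatives t"
    proof (rule image_subsetI)
      fix L assume "L \<in> A"
      then obtain i where i: "i \<in> totatives t" "has_type i L" using A_type by blast
      show "types L \<in> (\<lambda>i. {i, t - i}) ` totatives t" unfolding types[OF i] using i(1) by (rule imageI)
    qed
    show "(\<lambda>i. {i, t - i}) ` totatives t \<subseteq> types ` A"
    proof (rule image_subsetI)
      fix i assume i: "i \<in> totatives t"
      then obtain L where L: "has_type i L" using has_type_exists by (auto simp: totatives_def)
      then have "L \<in> A" by (simp add: A_def has_type_imp_pseudoregulus_type)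
      then show "{i, t - i} \<in> types ` A" using types[OF i L] by (metis imageI)
    qed
  qed
  also have "card \<dots> = totient t div 2" using t_ge_3 by (rule card_totative_pairs)
  finally show ?thesis unfolding A_def .
qed

end
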